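(* Let $n\geqslant2$ and $s_1>n+1$. Let $\psi_0,\psi_1$ satisfy $\langle D\rangle^{s_1+1}\psi_0\in L^1(\mathbb{R}^n)$ and $\langle D\rangle^{s_1}\psi_1\in L^1(\mathbb{R}^n)$, and suppose that $\psi_2=b\nu\Delta\psi_1+\Delta\psi_0$. Let $\psi$ be the solution to the linear Blackstock problem with data $(\psi_0,\psi_1,\psi_2)$, let $\psi^{(0)}$ be the solution to the viscoelastic damped wave equation with data $(\psi_0,\psi_1)$ (both problems are written in the context), and let $u:=\psi-\psi^{(0)}$. Then $$\sup_{t\in[0,\infty)}\|u(t,\cdot)\|_{L^\infty}\leqslant\sqrt\kappa\,C\left(\|\langle D\rangle^{s_1+1}\psi_0\|_{L^1}+\|\langle D\rangle^{s_1}\psi_1\|_{L^1}\right),$$ where $C$ is a positive constant independent of $\kappa$.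
   Context: Parameters: $b>0$, $\nu>0$, $\gamma\in(1,5/3]$, $\delta:=b\nu+(\gamma-1)\kappa$, and $0<\kappa\ll1$, i.e. $\kappa>0$ is sufficiently small with respect to the other parameters. The initial data are independent of $\kappa$; standing assumption: $\psi_0$ and $\psi_1$ are nontrivial, and $\psi_2$ is nontrivial. Linear Blackstock problem ($x\in\mathbb{R}^n$, $t>0$): $$(\partial_t-\kappa\Delta)(\psi_{tt}-\Delta\psi-\delta\Delta\psi_t)+\kappa(\gamma-1)(b\nu-\kappa)\Delta^2\psi_t=0,\quad \psi(0,x)=\psi_0(x),\ \psi_t(0,x)=\psi_1(x),\ \psi_{tt}(0,x)=\psi_2(x).$$ Viscoelastic damped wave equation ($x\in\mathbb{R}^n$, $t>0$): $$\psi^{(0)}_{tt}-\Delta\psi^{(0)}-b\nu\Delta\psi^{(0)}_t=0,\quad \psi^{(0)}(0,x)=\psi_0(x),\ \psi^{(0)}_t(0,x)=\psi_1(x).$$ Solutions are obtained by solving the corresponding linear ODEs in $t$ for the partial Fourier transform with respect to $x$. $\langle D\rangle^s$ is the pseudo-differential operator with symbol $\langle\xi\rangle^s$, $\langle\xi\rangle:=\sqrt{1+|\xi|^2}$. The constant $C$ does not depend on the data either. *)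

theory Defs
  imports "HOL-Probability.Essential_Supremum"
begin

definition fourier :: "(real^'n::finite \<Rightarrow> complex) \<Rightarrow> real^'n \<Rightarrow> complex" where
  "fourier f \<xi> = (LINT x|lebesgue. exp (- (\<i> * of_real (x \<bullet> \<xi>))) * f x)"

definition inverse_fourier :: "(real^'n::finite \<Rightarrow> complex) \<Rightarrow> real^'n \<Rightarrow> complex" where
  "inverse_fourier g x =
     (LINT \<xi>|lebesgue. exp (\<i> * of_real (x \<bullet> \<xi>)) * g \<xi>) / (2 * of_real pi) ^ CARD('n)"

definition L1_norm :: "(real^'n::finite \<Rightarrow> complex) \<Rightarrow> real" where
  "L1_norm f = (LINT x|lebesgue. norm (f x))"

definition Linf_norm :: "(real^'n::finite \<Rightarrow> complex) \<Rightarrow> ereal" where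
  "Linf_norm f = esssup lebesgue (\<lambda>x. ereal (norm (f x)))"

definition nontrivial :: "(real^'n::finite \<Rightarrow> complex) \<Rightarrow> bool" where
  "nontrivial f \<longleftrightarrow> \<not> (AE x in lebesgue. f x = 0)"

text \<open>\<open>g\<close> is the image of \<open>f\<close> under the pseudo-differential operator with symbol \<open>m\<close>, and
  both are \<open>L\<^sup>1\<close> functions.  By injectivity of the Fourier transform \<open>g\<close> is determined by \<open>f\<close>
  almost everywhere, and for symbols of polynomial growth it is the image of \<open>f\<close> in the sense of
  tempered distributions.\<close>

definition L1_symbol_op ::
    "(real^'n::finite \<Rightarrow> real) \<Rightarrow> (real^'n \<Rightarrow> complex) \<Rightarrow> (real^'n \<Rightarrow> complex) \<Rightarrow> bool" where
  "L1_symbol_op m f g \<longleftrightarrow>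
     integrable lebesgue f \<and> integrable lebesgue g \<and>
     (\<forall>\<xi>. fourier g \<xi> = of_real (m \<xi>) * fourier f \<xi>)"

definition japanese_bracket :: "real^'n::finite \<Rightarrow> real" where
  "japanese_bracket \<xi> = sqrt (1 + (norm \<xi>)\<^sup>2)"

text \<open>\<open>g\<close> is \<open>\<langle>D\<rangle>\<^sup>s f\<close> and lies in \<open>L\<^sup>1\<close>.  Requiring \<open>f\<close> itself to be an \<open>L\<^sup>1\<close> function is no
  restriction for \<open>s > 0\<close>: the symbol of \<open>\<langle>D\<rangle>\<close> to the power \<open>-s\<close> is the Fourier transform of an
  integrable Bessel kernel.\<close>

definition japanese_D :: "real \<Rightarrow> (real^'n::finite \<Rightarrow> complex) \<Rightarrow> (real^'n \<Rightarrow> complex) \<Rightarrow> bool" where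
  "japanese_D s = L1_symbol_op (\<lambda>\<xi>. japanese_bracket \<xi> powr s)"

definition laplace_symbol :: "real^'n::finite \<Rightarrow> real" where
  "laplace_symbol \<xi> = - (norm \<xi>)\<^sup>2"

text \<open>The Laplacian \<open>g\<close> of \<open>f\<close> in the sense of distributions, for \<open>f\<close> and \<open>g\<close> in \<open>L\<^sup>1\<close>.\<close>

definition laplacian :: "(real^'n::finite \<Rightarrow> complex) \<Rightarrow> (real^'n \<Rightarrow> complex) \<Rightarrow> bool" where
  "laplacian = L1_symbol_op laplace_symbol"

text \<open>In the two ordinary differential equations, \<open>l\<close> is the value of the symbol of the Laplacian
  at the frequency considered, and \<open>w\<close>, \<open>w1\<close>, \<open>w2\<close>, \<open>w3\<close> are the partial Fourier transform of the
  solution and its time derivatives (one-sided at time 0).  In the first one,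
  \<open>(\<partial>\<^sub>t - \<kappa> \<Delta>)\<close> has been applied to \<open>\<psi>\<^sub>t\<^sub>t - \<Delta> \<psi> - \<delta> \<Delta> \<psi>\<^sub>t\<close>.\<close>

definition blackstock_ode ::
    "real \<Rightarrow> real \<Rightarrow> real \<Rightarrow> real \<Rightarrow> real \<Rightarrow> complex \<Rightarrow> complex \<Rightarrow> complex \<Rightarrow> (real \<Rightarrow> complex) \<Rightarrow> bool" where
  "blackstock_ode b \<nu> \<gamma> \<kappa> l a0 a1 a2 w \<longleftrightarrow>
     (let \<delta> = b * \<nu> + (\<gamma> - 1) * \<kappa> in
      \<exists>w1 w2 w3.
        (\<forall>t\<ge>0. (w has_vector_derivative w1 t) (at t within {0..}) \<and>
                (w1 has_vector_derivative w2 t) (at t within {0..}) \<and>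
                (w2 has_vector_derivative w3 t) (at t within {0..}) \<and>
                (w3 t - of_real l * w1 t - of_real (\<delta> * l) * w2 t)
                  - of_real (\<kappa> * l) * (w2 t - of_real l * w t - of_real (\<delta> * l) * w1 t)
                  + of_real (\<kappa> * (\<gamma> - 1) * (b * \<nu> - \<kappa>) * l\<^sup>2) * w1 t = 0) \<and>
        w 0 = a0 \<and> w1 0 = a1 \<and> w2 0 = a2)"

definition viscoelastic_ode ::
    "real \<Rightarrow> real \<Rightarrow> real \<Rightarrow> complex \<Rightarrow> complex \<Rightarrow> (real \<Rightarrow> complex) \<Rightarrow> bool" where
  "viscoelastic_ode b \<nu> l a0 a1 w \<longleftrightarrow>
     (\<exists>w1 w2.
        (\<forall>t\<ge>0. (w has_vector_derivative w1 t) (at t within {0..}) \<and>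
                (w1 has_vector_derivative w2 t) (at t within {0..}) \<and>
                w2 t - of_real l * w t - of_real (b * \<nu> * l) * w1 t = 0) \<and>
        w 0 = a0 \<and> w1 0 = a1)"

text \<open>A solution \<open>\<psi>\<close> is recovered from the solutions of the differential equations, frequency by
  frequency, by Fourier inversion.  Integrability of the partial Fourier transform in the frequency
  is not demanded: for data with enough \<open>\<langle>D\<rangle>\<close>-regularity it is a consequence.\<close>

definition blackstock_solution ::
    "real \<Rightarrow> real \<Rightarrow> real \<Rightarrow> real \<Rightarrow> (real^'n::finite \<Rightarrow> complex) \<Rightarrow> (real^'n \<Rightarrow> complex) \<Rightarrow>
     (real^'n \<Rightarrow> complex) \<Rightarrow> (real \<Rightarrow> real^'n \<Rightarrow> complex) \<Rightarrow> bool" where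
  "blackstock_solution b \<nu> \<gamma> \<kappa> \<psi>0 \<psi>1 \<psi>2 \<psi> \<longleftrightarrow>
     (\<exists>w. (\<forall>\<xi>. blackstock_ode b \<nu> \<gamma> \<kappa> (laplace_symbol \<xi>)
                 (fourier \<psi>0 \<xi>) (fourier \<psi>1 \<xi>) (fourier \<psi>2 \<xi>) (\<lambda>t. w t \<xi>)) \<and>
          (\<forall>t\<ge>0. \<psi> t = inverse_fourier (w t)))"

definition viscoelastic_solution ::
    "real \<Rightarrow> real \<Rightarrow> (real^'n::finite \<Rightarrow> complex) \<Rightarrow> (real^'n \<Rightarrow> complex) \<Rightarrow>
     (real \<Rightarrow> real^'n \<Rightarrow> complex) \<Rightarrow> bool" where
  "viscoelastic_solution b \<nu> \<psi>0 \<psi>1 \<psi> \<longleftrightarrow>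
     (\<exists>w. (\<forall>\<xi>. viscoelastic_ode b \<nu> (laplace_symbol \<xi>)
                 (fourier \<psi>0 \<xi>) (fourier \<psi>1 \<xi>) (\<lambda>t. w t \<xi>)) \<and>
          (\<forall>t\<ge>0. \<psi> t = inverse_fourier (w t)))"

end

theory Submission
  imports Defs "HOL-Analysis.Ball_Volume"
begin

text \<open>
  At a frequency with \<open>r = \<bar>\<xi>\<bar>\<^sup>2 > 0\<close> put \<open>\<beta> = b \<nu>\<close>, let \<open>w\<close> and \<open>v\<close> be the Fourier
  transforms of the two solutions, \<open>u = w - v\<close>, and let \<open>H\<close> be defined by
  \<open>r H = u'' + \<beta> r u' + r u\<close>.  The Blackstock equation factorises as
  \<open>H' = \<kappa> r ((\<gamma> - 1) (u + v) - \<gamma> H)\<close>, and the condition on \<open>\<psi>\<^sub>2\<close> says \<open>H(0) = 0\<close>.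
  This is a damped gradient system for the positive definite potential
  \<open>V = \<bar>u\<bar>\<^sup>2 / 2 - u \<bullet> H + \<gamma> \<bar>H\<bar>\<^sup>2 / (2 (\<gamma> - 1))\<close>, forced by \<open>v\<close>, so that
  \<open>\<bar>u'\<bar>\<^sup>2 / 2 + r V\<close> grows at most at the rate \<open>\<kappa> (\<gamma> - 1) r\<^sup>2 \<bar>v\<bar>\<^sup>2 / 4\<close>.  The viscoelastic
  equation has a Lyapunov function with derivative \<open>- r \<bar>v\<bar>\<^sup>2\<close>, which absorbs this growth and
  yields \<open>\<bar>u\<bar> \<le> C \<surd>\<kappa> (\<bar>w'(0)\<bar> / \<bar>\<xi>\<bar> + (1 + \<bar>\<xi>\<bar>) \<bar>w(0)\<bar>)\<close> uniformly in time.  The decay of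
  the Fourier transforms of the data makes the right-hand side integrable in \<open>\<xi>\<close>.
\<close>

subsection \<open>Energy estimates at a fixed frequency\<close>

text \<open>At 0 the derivative is one-sided, so the monotonicity argument takes derivatives on the
  open interval and only continuity at its endpoints.\<close>

lemma nonincreasing_on_halfline:
  fixes f :: "real \<Rightarrow> real"
  assumes f: "\<And>t. t \<ge> 0 \<Longrightarrow> (f has_real_derivative f' t) (at t within {0..})"
    and f': "\<And>t. t \<ge> 0 \<Longrightarrow> f' t \<le> 0" and t: "t \<ge> 0"
  shows "f t \<le> f 0"
proof (rule DERIV_nonpos_imp_decreasing_open[OF t])
  fix s :: real assume s: "0 < s" "s < t"
  then have "at s within {0..} = at s" by (intro at_within_interior) auto
  then show "\<exists>y. (f has_real_derivative y) (at s) \<and> y \<le> 0"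
    using f[of s] f'[of s] s by auto
next
  have "continuous_on {0..} f"
    using f DERIV_continuous unfolding continuous_on_eq_continuous_within by fastforce
  then show "continuous_on {0..t} f"
    by (rule continuous_on_subset) auto
qed

text \<open>The mechanical energy dissipates only through the velocity. Divided by
  \<open>\<beta> * r\<close> it loses exactly \<open>y \<bullet> y\<close> per unit time, which the
  derivative of the cross term \<open>y \<bullet> x\<close> gives back together with a loss in the
  position; the last summand cancels the mixed terms.\<close>

definition viscoelastic_energy :: "real \<Rightarrow> real \<Rightarrow> 'a::real_inner \<Rightarrow> 'a \<Rightarrow> real" where
  "viscoelastic_energy \<beta> r x y =
     (y \<bullet> y + r * (x \<bullet> x)) / (2 * \<beta> * r) + y \<bullet> x + \<beta> * r / 2 * (x \<bullet> x)"

text \<open>Completing the square in \<open>y\<close> absorbs the cross term and the last summand,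
  and what remains is the potential part
  \<open>r * (x \<bullet> x) / (2 * \<beta> * r)\<close>.\<close>

lemma viscoelastic_energy_ge:
  assumes "\<beta> > 0" "r > 0"
  shows "(norm x)\<^sup>2 / (2 * \<beta>) \<le> viscoelastic_energy \<beta> r x y"
proof -
  have "0 \<le> (y + (\<beta> * r) *\<^sub>R x) \<bullet> (y + (\<beta> * r) *\<^sub>R x) / (2 * \<beta> * r)"
    using assms by simp
  also have "\<dots> = viscoelastic_energy \<beta> r x y - (norm x)\<^sup>2 / (2 * \<beta>)"
    using assms unfolding viscoelastic_energy_def power2_norm_eq_inner
    by (simp add: inner_add inner_commute field_simps power2_eq_square)
  finally show ?thesis by simp
qed

text \<open>The cross term is removed by Young's inequality. The right-hand side is a perfect
  square, so that its root is linear in the norms of the data; with \<open>r\<close> the squared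
  frequency it shows the low-frequency singularity on \<open>y\<close> and the loss of one order on
  \<open>x\<close>.\<close>

lemma viscoelastic_energy_le:
  assumes "\<beta> > 0" "r > 0"
  shows "viscoelastic_energy \<beta> r x y
    \<le> (1 / \<beta> + \<beta>) * (norm y / sqrt r + (1 + sqrt r) * norm x)\<^sup>2"
proof -
  have "0 \<le> (y - (\<beta> * r) *\<^sub>R x) \<bullet> (y - (\<beta> * r) *\<^sub>R x) / (2 * \<beta> * r)"
    using assms by simp
  also have "\<dots> = (y \<bullet> y) / (\<beta> * r) + (1 / (2 * \<beta>) + \<beta> * r) * (x \<bullet> x)
      - viscoelastic_energy \<beta> r x y"
    using assms unfolding viscoelastic_energy_def
    by (simp add: inner_diff inner_commute field_simps power2_eq_square)
  finally have "viscoelastic_energy \<beta> r x y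
      \<le> (norm y)\<^sup>2 / (\<beta> * r) + (1 / (2 * \<beta>) + \<beta> * r) * (norm x)\<^sup>2"
    by (simp add: power2_norm_eq_inner)
  also have "\<dots> \<le> (1 / \<beta> + \<beta>) * ((norm y)\<^sup>2 / r) + ((1 / \<beta> + \<beta>) * (1 + r)) * (norm x)\<^sup>2"
  proof (intro add_mono mult_right_mono)
    have "(norm y)\<^sup>2 / (\<beta> * r) = (1 / \<beta>) * ((norm y)\<^sup>2 / r)" by simp
    also have "\<dots> \<le> (1 / \<beta> + \<beta>) * ((norm y)\<^sup>2 / r)"
      using assms by (intro mult_right_mono) auto
    finally show "(norm y)\<^sup>2 / (\<beta> * r) \<le> (1 / \<beta> + \<beta>) * ((norm y)\<^sup>2 / r)" .
    have "(1 / \<beta> + \<beta>) * (1 + r) = 1 / (2 * \<beta>) + \<beta> * r + (1 / (2 * \<beta>) + \<beta> + r / \<beta>)"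
      by (simp add: distrib_left distrib_right)
    moreover have "0 \<le> 1 / (2 * \<beta>) + \<beta> + r / \<beta>" using assms by simp
    ultimately show "1 / (2 * \<beta>) + \<beta> * r \<le> (1 / \<beta> + \<beta>) * (1 + r)" by linarith
  qed simp
  also have "\<dots> = (1 / \<beta> + \<beta>) * ((norm y)\<^sup>2 / r + (1 + r) * (norm x)\<^sup>2)"
    by (subst distrib_left) (simp only: mult.assoc)
  also have "\<dots> \<le> (1 / \<beta> + \<beta>) * (norm y / sqrt r + (1 + sqrt r) * norm x)\<^sup>2"
  proof (rule mult_left_mono)
    define S where "S = sqrt r"
    have S: "S > 0" "S\<^sup>2 = r" using assms by (auto simp: S_def)
    have "(norm y / S + (1 + S) * norm x)\<^sup>2 = (norm y)\<^sup>2 / S\<^sup>2 + (1 + S\<^sup>2) * (norm x)\<^sup>2 +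
      (2 * S * (norm x)\<^sup>2 + 2 * (norm y / S) * ((1 + S) * norm x))"
    proof -
      have "(a + (1 + S) * c)\<^sup>2 = a\<^sup>2 + (1 + S\<^sup>2) * c\<^sup>2 + (2 * S * c\<^sup>2 + 2 * a * ((1 + S) * c))"
        for a c by (simp add: power2_eq_square algebra_simps)
      from this[of "norm y / S" "norm x"] show ?thesis by (simp only: power_divide)
    qed
    moreover have "0 \<le> 2 * S * (norm x)\<^sup>2 + 2 * (norm y / S) * ((1 + S) * norm x)"
      using S by simp
    ultimately show "(norm y)\<^sup>2 / r + (1 + r) * (norm x)\<^sup>2
        \<le> (norm y / sqrt r + (1 + sqrt r) * norm x)\<^sup>2"
      unfolding S_def[symmetric] S(2) by linarith
  qed (use assms in simp)
  finally show ?thesis .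
qed

lemma has_real_derivative_inner:
  fixes f g :: "real \<Rightarrow> 'a::real_inner"
  assumes "(f has_vector_derivative f') (at t within S)"
    and "(g has_vector_derivative g') (at t within S)"
  shows "((\<lambda>s. f s \<bullet> g s) has_real_derivative (f t \<bullet> g' + f' \<bullet> g t)) (at t within S)"
  using bounded_bilinear.has_vector_derivative[OF bounded_bilinear_inner assms]
  by (simp add: has_real_derivative_iff_has_vector_derivative)

lemma viscoelastic_energy_deriv:
  fixes v v1 v2 :: "real \<Rightarrow> 'a::real_inner"
  assumes "\<beta> > 0" "r > 0"
    and v: "(v has_vector_derivative v1 t) (at t within S)"
    and v1: "(v1 has_vector_derivative v2 t) (at t within S)"
    and ode: "v2 t + (\<beta> * r) *\<^sub>R v1 t + r *\<^sub>R v t = 0"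
  shows "((\<lambda>t. viscoelastic_energy \<beta> r (v t) (v1 t)) has_real_derivative
           - r * (v t \<bullet> v t)) (at t within S)"
proof -
  have v2: "v2 t = - ((\<beta> * r) *\<^sub>R v1 t + r *\<^sub>R v t)"
    using ode by (simp add: add_eq_0_iff2 add.assoc)
  have nz: "2 * \<beta> * r \<noteq> 0" using assms(1,2) by simp
  show ?thesis
    unfolding viscoelastic_energy_def
    by (rule nz has_real_derivative_inner[OF v v] has_real_derivative_inner[OF v1 v1]
          has_real_derivative_inner[OF v1 v] numeral_neq_zero derivative_eq_intros refl)+
      (use assms(1,2) in \<open>simp_all add: v2 inner_diff inner_commute field_simps power2_eq_square\<close>)
qed

lemma viscoelastic_bound:
  fixes v v1 v2 :: "real \<Rightarrow> 'a::real_inner"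
  assumes "\<beta> > 0" "r > 0"
    and v: "\<And>t. t \<ge> 0 \<Longrightarrow> (v has_vector_derivative v1 t) (at t within {0..})"
    and v1: "\<And>t. t \<ge> 0 \<Longrightarrow> (v1 has_vector_derivative v2 t) (at t within {0..})"
    and ode: "\<And>t. t \<ge> 0 \<Longrightarrow> v2 t + (\<beta> * r) *\<^sub>R v1 t + r *\<^sub>R v t = 0"
    and t: "t \<ge> 0"
  shows "(norm (v t))\<^sup>2 \<le> 2 * \<beta> * viscoelastic_energy \<beta> r (v 0) (v1 0)"
proof -
  have "(norm (v t))\<^sup>2 / (2 * \<beta>) \<le> viscoelastic_energy \<beta> r (v t) (v1 t)"
    by (rule viscoelastic_energy_ge[OF assms(1,2)])
  also have "\<dots> \<le> viscoelastic_energy \<beta> r (v 0) (v1 0)"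
  proof (rule nonincreasing_on_halfline[OF _ _ t])
    show "((\<lambda>t. viscoelastic_energy \<beta> r (v t) (v1 t)) has_real_derivative - r * (v s \<bullet> v s))
        (at s within {0..})" if "s \<ge> 0" for s
      by (intro viscoelastic_energy_deriv[where ?v2.0 = v2] assms(1,2) v v1 ode that)
    show "- r * (v s \<bullet> v s) \<le> 0" for s
      using \<open>r > 0\<close> by simp
  qed
  finally show ?thesis using assms(1) by (simp add: field_simps)
qed

text \<open>The factor \<open>\<kappa>\<close> stems from the forcing alone: \<open>u\<close>,
  \<open>u1\<close> and \<open>H\<close> start at zero, so at time 0 the functional
  \<open>\<Lambda>\<close> reduces to the multiple of the energy of \<open>v\<close> that was added
  to pay for the forcing.\<close>

lemma blackstock_difference_bound:
  fixes u v H :: "real \<Rightarrow> 'a::real_inner"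
  assumes "\<beta> > 0" "r > 0" "\<gamma> > 1" "\<kappa> > 0"
    and v: "\<And>t. t \<ge> 0 \<Longrightarrow> (v has_vector_derivative v1 t) (at t within {0..})"
    and v1: "\<And>t. t \<ge> 0 \<Longrightarrow> (v1 has_vector_derivative v2 t) (at t within {0..})"
    and vode: "\<And>t. t \<ge> 0 \<Longrightarrow> v2 t + (\<beta> * r) *\<^sub>R v1 t + r *\<^sub>R v t = 0"
    and u: "\<And>t. t \<ge> 0 \<Longrightarrow> (u has_vector_derivative u1 t) (at t within {0..})"
    and u1: "\<And>t. t \<ge> 0 \<Longrightarrow> (u1 has_vector_derivative u2 t) (at t within {0..})"
    and uode: "\<And>t. t \<ge> 0 \<Longrightarrow> u2 t + (\<beta> * r) *\<^sub>R u1 t + r *\<^sub>R u t = r *\<^sub>R H t"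
    and H: "\<And>t. t \<ge> 0 \<Longrightarrow> (H has_vector_derivative
              (\<kappa> * r) *\<^sub>R ((\<gamma> - 1) *\<^sub>R (u t + v t) - \<gamma> *\<^sub>R H t)) (at t within {0..})"
    and init: "u 0 = 0" "u1 0 = 0" "H 0 = 0"
    and t: "t \<ge> 0"
  shows "(norm (u t))\<^sup>2 \<le> \<kappa> * (\<gamma> * (\<gamma> - 1) / 2) * viscoelastic_energy \<beta> r (v 0) (v1 0)"
proof -
  \<comment> \<open>With this \<open>g\<close> the partial gradients of \<open>V\<close> are
    \<open>u - H\<close> and \<open>g *\<^sub>R H - u\<close>. The equation for \<open>u\<close> is
    a damped second-order motion in \<open>V\<close>, the one for \<open>H\<close> a first-order
    descent, perturbed by \<open>v\<close>.\<close>
  define g where "g = \<gamma> / (\<gamma> - 1)"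
  define V where "V = (\<lambda>t. u t \<bullet> u t / 2 - u t \<bullet> H t + g / 2 * (H t \<bullet> H t))"
  define \<Phi> where "\<Phi> = (\<lambda>t. viscoelastic_energy \<beta> r (v t) (v1 t))"
  \<comment> \<open>The energy \<open>\<Phi>\<close> decays at the rate
    \<open>r * (v \<bullet> v)\<close>, so its weight is chosen to match the term that completing
    the square leaves of the forcing.\<close>
  define \<Lambda> where "\<Lambda> = (\<lambda>t. u1 t \<bullet> u1 t / 2 + r * V t + (\<gamma> - 1) / 4 * \<kappa> * r * \<Phi> t)"
  define K where "K = (\<lambda>t. (\<kappa> * r) *\<^sub>R ((\<gamma> - 1) *\<^sub>R (u t + v t) - \<gamma> *\<^sub>R H t))"
  have g: "g * (\<gamma> - 1) = \<gamma>" "g > 0" using \<open>\<gamma> > 1\<close> by (simp_all add: g_def)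
  have \<Phi>': "(\<Phi> has_real_derivative - r * (v t \<bullet> v t)) (at t within {0..})" if "t \<ge> 0" for t
    unfolding \<Phi>_def
    by (intro viscoelastic_energy_deriv[where ?v2.0 = v2] assms(1,2) v v1 vode that)
  have V': "(V has_real_derivative (u t - H t) \<bullet> u1 t + (g *\<^sub>R H t - u t) \<bullet> K t) (at t within {0..})"
    if "t \<ge> 0" for t
    unfolding V_def K_def
    by (rule has_real_derivative_inner[OF u[OF that] u[OF that]]
          has_real_derivative_inner[OF u[OF that] H[OF that]]
          has_real_derivative_inner[OF H[OF that] H[OF that]] numeral_neq_zero derivative_eq_intros refl)+
      (simp add: inner_diff inner_add inner_commute algebra_simps)
  have \<Lambda>': "(\<Lambda> has_real_derivative
      u1 t \<bullet> u2 t + r * ((u t - H t) \<bullet> u1 t + (g *\<^sub>R H t - u t) \<bullet> K t)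
      - (\<gamma> - 1) / 4 * \<kappa> * r\<^sup>2 * (v t \<bullet> v t)) (at t within {0..})" if "t \<ge> 0" for t
    unfolding \<Lambda>_def
    by (rule V'[OF that] \<Phi>'[OF that] has_real_derivative_inner[OF u1[OF that] u1[OF that]]
          numeral_neq_zero derivative_eq_intros refl)+
      (simp add: inner_commute power2_eq_square field_simps)
  have decay: "u1 t \<bullet> u2 t + r * ((u t - H t) \<bullet> u1 t + (g *\<^sub>R H t - u t) \<bullet> K t)
      - (\<gamma> - 1) / 4 * \<kappa> * r\<^sup>2 * (v t \<bullet> v t) \<le> 0" if "t \<ge> 0" for t
  proof -
    define Y where "Y = g *\<^sub>R H t - u t"
    \<comment> \<open>The descent contributes a negative multiple of
      \<open>Y \<bullet> Y - Y \<bullet> v\<close>. This is \<open>Z \<bullet> Z\<close> minus a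
      quarter of \<open>v \<bullet> v\<close>, and the quarter cancels against the decay of
      \<open>\<Phi>\<close>.\<close>
    define Z where "Z = Y - (1 / 2) *\<^sub>R v t"
    have u2: "u2 t = r *\<^sub>R (H t - u t) - (\<beta> * r) *\<^sub>R u1 t"
      using uode[OF that] by (simp add: algebra_simps)
    have K: "K t = (- (\<kappa> * r * (\<gamma> - 1))) *\<^sub>R (Y - v t)"
    proof -
      have "\<gamma> *\<^sub>R H t = (\<gamma> - 1) *\<^sub>R (g *\<^sub>R H t)" using g(1) by (simp add: mult.commute)
      then show ?thesis unfolding K_def Y_def by (simp add: scaleR_diff_right scaleR_add_right)
    qed
    have "u1 t \<bullet> u2 t + r * ((u t - H t) \<bullet> u1 t + Y \<bullet> K t) - (\<gamma> - 1) / 4 * \<kappa> * r\<^sup>2 * (v t \<bullet> v t)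
      = - (\<beta> * r * (u1 t \<bullet> u1 t)) - \<kappa> * r\<^sup>2 * (\<gamma> - 1) * (Z \<bullet> Z)"
      unfolding u2 K Z_def
      by (simp add: inner_diff inner_add inner_commute field_simps power2_eq_square)
    also have "\<dots> \<le> 0"
    proof -
      have "0 \<le> \<beta> * r * (u1 t \<bullet> u1 t)" "0 \<le> \<kappa> * r\<^sup>2 * (\<gamma> - 1) * (Z \<bullet> Z)"
        using assms(1-4) by simp_all
      then show ?thesis by linarith
    qed
    finally show ?thesis by (simp add: Y_def)
  qed
  \<comment> \<open>For fixed \<open>u\<close>, the potential is smallest at
    \<open>u = g *\<^sub>R H\<close>, where the coefficient of the squared norm is
    \<open>1 / 2 - 1 / (2 * g)\<close>.\<close>
  have "(norm (u t))\<^sup>2 / (2 * \<gamma>) \<le> V t"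
  proof -
    have "0 \<le> (u t - g *\<^sub>R H t) \<bullet> (u t - g *\<^sub>R H t) / (2 * g)"
      using \<open>\<gamma> > 1\<close> by (simp add: g_def)
    also have "\<dots> = V t - (norm (u t))\<^sup>2 * (1 / 2 - 1 / (2 * g))"
      using g(2) unfolding V_def power2_norm_eq_inner
      by (simp add: inner_diff inner_commute field_simps)
    also have "1 / 2 - 1 / (2 * g) = 1 / (2 * \<gamma>)"
      using \<open>\<gamma> > 1\<close> by (simp add: g_def field_simps)
    finally show ?thesis by simp
  qed
  then have "r * ((norm (u t))\<^sup>2 / (2 * \<gamma>)) \<le> r * V t"
    using \<open>r > 0\<close> by (intro mult_left_mono) auto
  also have "\<dots> \<le> \<Lambda> t"
    using assms(1-4) viscoelastic_energy_ge[OF assms(1,2), of "v t" "v1 t"]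
    unfolding \<Lambda>_def \<Phi>_def
    by (smt (verit) divide_nonneg_pos inner_ge_zero mult_nonneg_nonneg zero_le_power2)
  also have "\<dots> \<le> \<Lambda> 0"
    by (rule nonincreasing_on_halfline[OF \<Lambda>' decay t])
  also have "\<Lambda> 0 = (\<gamma> - 1) / 4 * \<kappa> * r * \<Phi> 0"
    by (simp add: \<Lambda>_def V_def init)
  finally have "r * ((norm (u t))\<^sup>2 / (2 * \<gamma>)) \<le> r * ((\<gamma> - 1) / 4 * \<kappa> * \<Phi> 0)"
    by (simp add: mult_ac)
  then have "(norm (u t))\<^sup>2 / (2 * \<gamma>) \<le> (\<gamma> - 1) / 4 * \<kappa> * \<Phi> 0"
    using \<open>r > 0\<close> by (simp only: mult_le_cancel_left_pos)
  then show ?thesis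
    using \<open>\<gamma> > 1\<close> by (simp add: \<Phi>_def field_simps)
qed

section \<open>Power series of solutions of third-order linear equations\<close>

text \<open>All derivatives of \<open>w\<close> satisfy the recurrence of the equation, hence grow
  at most geometrically, and the Taylor remainder vanishes. The coefficients \<open>c\<close>
  involve only the initial values and \<open>p\<close>, \<open>q\<close>, \<open>r\<close>; this is
  what later transfers measurability from the data to the solution.\<close>

lemma taylor_series_linear_ode:
  fixes w :: "real \<Rightarrow> 'a::banach" and c :: "nat \<Rightarrow> 'a"
  assumes w: "\<And>t. t \<ge> 0 \<Longrightarrow> (w has_vector_derivative w1 t) (at t within {0..})"
    and w1: "\<And>t. t \<ge> 0 \<Longrightarrow> (w1 has_vector_derivative w2 t) (at t within {0..})"
    and w2: "\<And>t. t \<ge> 0 \<Longrightarrow> (w2 has_vector_derivative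
               (p *\<^sub>R w2 t + q *\<^sub>R w1 t + r *\<^sub>R w t)) (at t within {0..})"
    and c: "c 0 = w 0" "c 1 = w1 0" "c 2 = w2 0"
    and c_rec: "\<And>k. c (k + 3) = p *\<^sub>R c (k + 2) + q *\<^sub>R c (k + 1) + r *\<^sub>R c k"
    and t: "t \<ge> 0"
  shows "(\<lambda>m. \<Sum>k<m. (t ^ k / fact k) *\<^sub>R c k) \<longlonglongrightarrow> w t"
proof -
  \<comment> \<open>A triple of consecutive derivatives is carried along because the recurrence
    reaches three steps back. That \<open>W k\<close> really is the k-th derivative of
    \<open>w\<close> on the half-line follows in \<open>W_deriv\<close>.\<close>
  define D where "D = rec_nat (\<lambda>s. (w s, w1 s, w2 s))
    (\<lambda>_ d s. case d s of (x, y, z) \<Rightarrow> (y, z, p *\<^sub>R z + q *\<^sub>R y + r *\<^sub>R x))"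
  define W where "W k s = fst (D k s)" for k s
  have D0: "D 0 = (\<lambda>s. (w s, w1 s, w2 s))" by (simp add: D_def)
  have D_Suc: "D (Suc k) s = (case D k s of (x, y, z) \<Rightarrow> (y, z, p *\<^sub>R z + q *\<^sub>R y + r *\<^sub>R x))" for k s
    by (simp add: D_def)
  have W0: "W 0 = w" "W 1 = w1" "W 2 = w2"
    by (auto simp: W_def D0 D_Suc fun_eq_iff numeral_2_eq_2)
  have W_rec: "W (k + 3) s = p *\<^sub>R W (k + 2) s + q *\<^sub>R W (k + 1) s + r *\<^sub>R W k s" for k s
    by (cases "D k s") (simp add: W_def D_Suc numeral_3_eq_3 numeral_2_eq_2)
  have three: "P k" if "P 0" "P 1" "P 2" "\<And>k. P k \<Longrightarrow> P (k + 1) \<Longrightarrow> P (k + 2) \<Longrightarrow> P (k + 3)"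
    for P :: "nat \<Rightarrow> bool" and k
  proof -
    have "P k \<and> P (k + 1) \<and> P (k + 2)"
      by (induction k) (use that in \<open>auto simp: numeral_eq_Suc\<close>)
    then show ?thesis by blast
  qed
  have W_deriv: "\<forall>s\<ge>0. (W k has_vector_derivative W (Suc k) s) (at s within {0..})" for k
  proof (induction k rule: three)
    case 1 then show ?case using w W0 by simp
  next
    case 2 then show ?case using w1 W0 by (simp add: numeral_2_eq_2)
  next
    case 3 then show ?case using w2 W0 W_rec[of 0] by (simp add: numeral_eq_Suc)
  next
    case (4 k)
    have "W (k + 3) = (\<lambda>s. p *\<^sub>R W (k + 2) s + q *\<^sub>R W (k + 1) s + r *\<^sub>R W k s)"
      using W_rec by auto
    moreover have "W (Suc (k + 3)) s = p *\<^sub>R W (Suc (k + 2)) s + q *\<^sub>R W (Suc (k + 1)) s + r *\<^sub>R W (Suc k) s" for s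
      using W_rec[of "Suc k"] by simp
    ultimately show ?case
      using 4 by (auto intro!: derivative_eq_intros)
  qed
  have Wc: "W k 0 = c k" for k
    by (induction k rule: three) (simp_all only: W0 c W_rec c_rec)
  have sub: "(W k has_vector_derivative W (Suc k) s) (at s within {0..t})" if "0 \<le> s" for k s
    using W_deriv that by (meson atLeastAtMost_iff atLeast_iff has_vector_derivative_within_subset subsetI)
  have "\<exists>B. \<forall>s\<in>{0..t}. norm (W k s) \<le> B" for k
  proof -
    have "continuous_on {0..t} (W k)"
      unfolding continuous_on_eq_continuous_within
      using sub has_vector_derivative_continuous by fastforce
    then have "bounded (W k ` {0..t})"
      by (intro compact_imp_bounded compact_continuous_image) auto
    then show ?thesis by (auto simp: bounded_iff)
  qed
  then obtain B where B: "\<And>k s. s \<in> {0..t} \<Longrightarrow> norm (W k s) \<le> B k" by metis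
  define M where "M = \<bar>B 0\<bar> + \<bar>B 1\<bar> + \<bar>B 2\<bar>"
  \<comment> \<open>One step of the recurrence multiplies the bound by at most the sum of the three
    absolute values; the summand 1 makes \<open>K\<close> at least 1, so that the highest power
    dominates the lower ones.\<close>
  define K where "K = 1 + \<bar>p\<bar> + \<bar>q\<bar> + \<bar>r\<bar>"
  have "M \<ge> 0" "K \<ge> 1" by (auto simp: M_def K_def)
  have bound: "\<forall>s\<in>{0..t}. norm (W k s) \<le> M * K ^ k" for k
  proof (induction k rule: three)
    case 1 show ?case using B[of _ 0] by (force simp: M_def)
  next
    case 2
    have "M \<le> M * K" using \<open>M \<ge> 0\<close> \<open>K \<ge> 1\<close> by (simp add: mult_le_cancel_left1)
    then show ?case using B[of _ 1] unfolding M_def by force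
  next
    case 3
    have "M * 1 \<le> M * K ^ 2"
      using \<open>M \<ge> 0\<close> \<open>K \<ge> 1\<close> by (intro mult_left_mono one_le_power)
    then show ?case using B[of _ 2] unfolding M_def by force
  next
    case (4 k)
    show ?case
    proof
      fix s assume s: "s \<in> {0..t}"
      have le: "M * K ^ k \<le> M * K ^ (k + 2)" "M * K ^ (k + 1) \<le> M * K ^ (k + 2)"
        by (rule mult_left_mono[OF power_increasing]; use \<open>M \<ge> 0\<close> \<open>K \<ge> 1\<close> in simp)+
      have "norm (W (k + 3) s) \<le> norm (p *\<^sub>R W (k + 2) s) + norm (q *\<^sub>R W (k + 1) s) + norm (r *\<^sub>R W k s)"
        unfolding W_rec by (meson add_mono norm_triangle_le order_refl)
      also have "\<dots> \<le> \<bar>p\<bar> * (M * K ^ (k + 2)) + \<bar>q\<bar> * (M * K ^ (k + 2)) + \<bar>r\<bar> * (M * K ^ (k + 2))"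
        unfolding norm_scaleR using 4 s le
        by (intro add_mono mult_left_mono) (auto intro: order_trans)
      also have "\<dots> = (K - 1) * (M * K ^ (k + 2))" by (simp add: K_def algebra_simps)
      also have "\<dots> \<le> K * (M * K ^ (k + 2))"
        using \<open>M \<ge> 0\<close> \<open>K \<ge> 1\<close> by (intro mult_right_mono) auto
      also have "\<dots> = M * K ^ (k + 3)" by (simp add: numeral_eq_Suc)
      finally show "norm (W (k + 3) s) \<le> M * K ^ (k + 3)" .
    qed
  qed
  \<comment> \<open>In the integral form of the remainder, the kernel is at most
    \<open>t ^ m / fact m\<close> and the derivative at most \<open>M * K ^ Suc m\<close>; the
    length of the interval supplies the last factor \<open>t\<close>.\<close>
  have rem: "norm (w t - (\<Sum>k<Suc m. (t ^ k / fact k) *\<^sub>R c k)) \<le> M * K * t * ((K * t) ^ m / fact m)" for m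
  proof -
    have "((\<lambda>s. ((t - s) ^ (Suc m - 1) / fact (Suc m - 1)) *\<^sub>R W (Suc m) s) has_integral
        w t - (\<Sum>k<Suc m. ((t - 0) ^ k / fact k) *\<^sub>R W k 0)) {0..t}"
      by (rule Taylor_has_integral) (use W0 sub t in auto)
    then have I: "((\<lambda>s. ((t - s) ^ m / fact m) *\<^sub>R W (Suc m) s) has_integral
        w t - (\<Sum>k<Suc m. (t ^ k / fact k) *\<^sub>R c k)) (cbox 0 t)"
      by (simp add: Wc)
    have "norm (w t - (\<Sum>k<Suc m. (t ^ k / fact k) *\<^sub>R c k))
        \<le> (t ^ m / fact m * (M * K ^ Suc m)) * measure lborel (cbox 0 t)"
    proof (rule has_integral_bound[OF _ I])
      show "0 \<le> t ^ m / fact m * (M * K ^ Suc m)"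
        using t \<open>M \<ge> 0\<close> \<open>K \<ge> 1\<close> by simp
      fix s assume "s \<in> cbox 0 t"
      then have s: "s \<in> {0..t}" by simp
      have "\<bar>(t - s) ^ m / fact m\<bar> \<le> t ^ m / fact m"
        using s by (auto simp: abs_divide power_abs intro!: divide_right_mono power_mono)
      then show "norm (((t - s) ^ m / fact m) *\<^sub>R W (Suc m) s) \<le> t ^ m / fact m * (M * K ^ Suc m)"
        unfolding norm_scaleR using bound[of "Suc m"] s t by (intro mult_mono) auto
    qed
    also have "\<dots> = M * K * t * ((K * t) ^ m / fact m)"
      using t by (simp add: power_mult_distrib)
    finally show ?thesis .
  qed
  have "(\<lambda>m. M * K * t * ((K * t) ^ m / fact m)) \<longlonglongrightarrow> M * K * t * 0"
    using summable_LIMSEQ_zero[OF summable_exp[of "K * t"]]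
    by (intro tendsto_intros) (simp add: field_simps)
  then have "(\<lambda>m. w t - (\<Sum>k<Suc m. (t ^ k / fact k) *\<^sub>R c k)) \<longlonglongrightarrow> 0"
    by (intro Lim_null_comparison[OF always_eventually[OF allI[OF rem]]]) simp
  then have "(\<lambda>m. w t - (w t - (\<Sum>k<Suc m. (t ^ k / fact k) *\<^sub>R c k))) \<longlonglongrightarrow> w t - 0"
    by (intro tendsto_intros)
  then have "(\<lambda>m. \<Sum>k<Suc m. (t ^ k / fact k) *\<^sub>R c k) \<longlonglongrightarrow> w t"
    by (simp del: sum.lessThan_Suc)
  then show ?thesis by (subst (asm) filterlim_sequentially_Suc)
qed

subsection \<open>Fourier transforms of integrable functions\<close>

lemma japanese_bracket_ge_1: "japanese_bracket \<xi> \<ge> 1"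
  by (simp add: japanese_bracket_def)

lemma japanese_bracket_ge_norm: "norm \<xi> \<le> japanese_bracket \<xi>"
  unfolding japanese_bracket_def by (rule real_le_rsqrt) simp

lemma continuous_on_japanese_bracket: "continuous_on S japanese_bracket"
  unfolding japanese_bracket_def by (intro continuous_intros)

text \<open>Dominated convergence with majorant \<open>norm (f x)\<close>. Continuity yields the
  measurability of the transformed data in frequency and, through the inverse transform, of the
  solutions in space.\<close>

lemma continuous_on_fourier:
  fixes f :: "real^'n::finite \<Rightarrow> complex"
  assumes f: "integrable lebesgue f"
  shows "continuous_on UNIV (fourier f)"
proof (rule continuous_on_sequentiallyI)
  fix y :: "nat \<Rightarrow> real^'n" and \<xi>
  assume y: "y \<longlonglongrightarrow> \<xi>"
  note [measurable] = borel_measurable_integrable[OF f]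
  have [measurable]: "(\<lambda>x. exp (- (\<i> * of_real (x \<bullet> z)))) \<in> borel_measurable lebesgue" for z :: "real^'n"
    by (intro measurable_completion) measurable
  show "(\<lambda>n. fourier f (y n)) \<longlonglongrightarrow> fourier f \<xi>"
    unfolding fourier_def
  proof (rule integral_dominated_convergence[where w = "\<lambda>x. norm (f x)"])
    show "AE x in lebesgue. (\<lambda>n. exp (- (\<i> * of_real (x \<bullet> y n))) * f x)
        \<longlonglongrightarrow> exp (- (\<i> * of_real (x \<bullet> \<xi>))) * f x"
      using y by (intro AE_I2 tendsto_intros)
  qed (use f in \<open>auto simp: norm_mult\<close>)
qed

lemma fourier_measurable:
  fixes f :: "real^'n::finite \<Rightarrow> complex"
  assumes "integrable lebesgue f"
  shows "fourier f \<in> borel_measurable lebesgue"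
  using borel_measurable_continuous_onI[OF continuous_on_fourier[OF assms]]
  by (intro measurable_completion) simp

lemma norm_fourier_le: "norm (fourier f \<xi>) \<le> L1_norm f"
proof -
  have "norm (fourier f \<xi>) \<le> (LINT x|lebesgue. norm (exp (- (\<i> * of_real (x \<bullet> \<xi>))) * f x))"
    unfolding fourier_def by (rule integral_norm_bound)
  then show ?thesis by (simp add: norm_mult L1_norm_def)
qed

lemma inverse_fourier_eq_fourier:
  fixes g :: "real^'n::finite \<Rightarrow> complex"
  shows "inverse_fourier g x = fourier g (- x) / (2 * of_real pi) ^ CARD('n)"
  by (simp add: inverse_fourier_def fourier_def inner_commute)

lemma integrable_exp_mult:
  fixes g :: "real^'n::finite \<Rightarrow> complex"
  assumes g: "integrable lebesgue g"
  shows "integrable lebesgue (\<lambda>x. exp (- (\<i> * of_real (x \<bullet> \<xi>))) * g x)"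
proof (rule Bochner_Integration.integrable_bound[OF g])
  have [measurable]: "(\<lambda>x. exp (- (\<i> * of_real (x \<bullet> \<xi>)))) \<in> borel_measurable lebesgue"
    by (intro measurable_completion) measurable
  show "(\<lambda>x. exp (- (\<i> * of_real (x \<bullet> \<xi>))) * g x) \<in> borel_measurable lebesgue"
    using g by measurable
qed (simp add: norm_mult)

lemma fourier_diff:
  fixes f g :: "real^'n::finite \<Rightarrow> complex"
  assumes "integrable lebesgue f" "integrable lebesgue g"
  shows "fourier (\<lambda>x. f x - g x) \<xi> = fourier f \<xi> - fourier g \<xi>"
  unfolding fourier_def right_diff_distrib
  by (intro Bochner_Integration.integral_diff integrable_exp_mult assms)

text \<open>This serves the condition on \<open>\<psi>2\<close>, which holds only almost everywhere;
  the measurability of \<open>h\<close> therefore rests on the completeness of Lebesgue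
  measure.\<close>

lemma fourier_lincomb:
  fixes f g :: "real^'n::finite \<Rightarrow> complex"
  assumes "integrable lebesgue f" "integrable lebesgue g"
    and h: "AE x in lebesgue. h x = c * f x + g x"
  shows "integrable lebesgue h" and "fourier h \<xi> = c * fourier f \<xi> + fourier g \<xi>"
proof -
  have fg: "integrable lebesgue (\<lambda>x. c * f x + g x)" using assms by simp
  have [measurable]: "h \<in> borel_measurable lebesgue"
    by (rule borel_measurable_AE[OF borel_measurable_integrable[OF fg]]) (use h in auto)
  show "integrable lebesgue h"
    by (subst integrable_cong_AE[OF _ _ h]) (use fg in auto)
  have [measurable]: "(\<lambda>x. exp (- (\<i> * of_real (x \<bullet> \<xi>)))) \<in> borel_measurable lebesgue"
    by (intro measurable_completion) measurable
  have [measurable]: "f \<in> borel_measurable lebesgue" "g \<in> borel_measurable lebesgue"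
    using assms by auto
  have "fourier h \<xi> = (LINT x|lebesgue. exp (- (\<i> * of_real (x \<bullet> \<xi>))) * (c * f x + g x))"
    unfolding fourier_def by (rule integral_cong_AE) (use h in auto)
  also have "\<dots> = (LINT x|lebesgue. c * (exp (- (\<i> * of_real (x \<bullet> \<xi>))) * f x)
      + exp (- (\<i> * of_real (x \<bullet> \<xi>))) * g x)"
    by (simp add: algebra_simps)
  also have "\<dots> = c * fourier f \<xi> + fourier g \<xi>"
    unfolding fourier_def
    by (subst Bochner_Integration.integral_add)
      (intro integrable_exp_mult assms integrable_mult_right | simp)+
  finally show "fourier h \<xi> = c * fourier f \<xi> + fourier g \<xi>" .
qed

text \<open>The transform of \<open>g\<close> is bounded by its \<open>L1_norm\<close>, and dividing
  by the symbol turns regularity into decay.\<close>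

lemma fourier_decay_japanese_D:
  assumes "japanese_D s f g"
  shows "norm (fourier f \<xi>) \<le> japanese_bracket \<xi> powr (- s) * L1_norm g"
proof -
  have J: "japanese_bracket \<xi> > 0" using japanese_bracket_ge_1[of \<xi>] by linarith
  have "fourier g \<xi> = of_real (japanese_bracket \<xi> powr s) * fourier f \<xi>"
    using assms by (simp add: japanese_D_def L1_symbol_op_def)
  then have "norm (fourier f \<xi>) = japanese_bracket \<xi> powr (- s) * norm (fourier g \<xi>)"
    using J by (simp add: norm_mult powr_minus)
  also have "\<dots> \<le> japanese_bracket \<xi> powr (- s) * L1_norm g"
    by (intro mult_left_mono norm_fourier_le) simp
  finally show ?thesis .
qed

section \<open>Integrability of the frequency weight\<close>

lemma dyadic_bracket:
  fixes y :: real
  assumes "y \<ge> 1"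
  obtains k where "2 ^ k \<le> y" "y < 2 ^ Suc k"
proof -
  obtain m where "y < 2 ^ m" using real_arch_pow[of 2 y] by auto
  then have "y < 2 ^ (LEAST m. y < 2 ^ m)" by (rule LeastI)
  moreover have "(LEAST m. y < 2 ^ m) \<noteq> 0"
    using \<open>y < 2 ^ (LEAST m. y < 2 ^ m)\<close> assms by (intro notI) simp
  then obtain k where k: "(LEAST m. y < 2 ^ m) = Suc k" using not0_implies_Suc by blast
  ultimately have "y < 2 ^ Suc k" by simp
  moreover have "\<not> y < 2 ^ k" using k not_less_Least[of k "\<lambda>m. y < 2 ^ m"] by simp
  ultimately show ?thesis using that[of k] by simp
qed

text \<open>The singularity \<open>1 / \<bar>\<xi>\<bar>\<close> is where the dimension has to be at least two.\<close>

lemma integrable_singular_weight: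
  assumes n: "CARD('n::finite) \<ge> 2" and s: "s \<ge> real CARD('n) + 1"
  shows "integrable lebesgue (\<lambda>\<xi> :: real^'n. (1 + 1 / norm \<xi>) * japanese_bracket \<xi> powr (- s))"
    (is "integrable _ ?h")
proof -
  define N where "N = CARD('n)"
  define V where "V = unit_ball_vol (real N)"
  have V: "V \<ge> 0" by (simp add: V_def)
  \<comment> \<open>The weight is dominated by a sum of constants on dyadic balls: \<open>g1\<close>
    treats the singularity at the origin, \<open>g2\<close> the decay at infinity. Full balls may
    replace annuli, since the overlaps only enlarge the sum.\<close>
  define g1 where "g1 = (\<lambda>k (\<xi> :: real^'n). ennreal (2 ^ (k + 2)) * indicator (cball 0 (1 / 2 ^ k)) \<xi>)"
  define g2 where "g2 = (\<lambda>k (\<xi> :: real^'n). ennreal (2 * (1 / 2 ^ k) ^ (N + 1)) * indicator (cball 0 (2 ^ Suc k)) \<xi>)"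
  define g where "g = (\<lambda>k \<xi>. g1 k \<xi> + g2 k \<xi>)"
  have [measurable]: "?h \<in> borel_measurable borel"
  proof -
    have [measurable]: "(japanese_bracket :: real^'n \<Rightarrow> real) \<in> borel_measurable borel"
      by (intro borel_measurable_continuous_onI continuous_on_japanese_bracket)
    show ?thesis by measurable
  qed
  have [measurable]: "g1 k \<in> borel_measurable borel" "g2 k \<in> borel_measurable borel" for k
    unfolding g1_def g2_def
    by (auto intro!: borel_measurable_times_ennreal borel_measurable_indicator)
  have [measurable]: "g k \<in> borel_measurable borel" for k
    unfolding g_def by measurable
  have "\<exists>k. ennreal (?h \<xi>) \<le> g k \<xi>" for \<xi> :: "real^'n"
  proof (cases "norm \<xi> \<le> 1")
    case True
    have "japanese_bracket \<xi> powr (- s) \<le> 1"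
      using powr_mono[of "- s" 0 "japanese_bracket \<xi>"] japanese_bracket_ge_1[of \<xi>] s by simp
    then have h: "?h \<xi> \<le> 1 + 1 / norm \<xi>"
      by (intro mult_left_le) simp_all
    have "\<exists>k. norm \<xi> \<le> 1 / 2 ^ k \<and> 1 + 1 / norm \<xi> \<le> 2 ^ (k + 2)"
    \<comment> \<open>At the origin \<open>1 / norm \<xi>\<close> is 0 by the convention for
      division, and \<open>k = 0\<close> serves.\<close>
    proof (cases "\<xi> = 0")
      case False
      then have "1 / norm \<xi> \<ge> 1" using True by simp
      then obtain k where k: "2 ^ k \<le> 1 / norm \<xi>" "1 / norm \<xi> < 2 ^ Suc k"
        by (rule dyadic_bracket)
      have "norm \<xi> \<le> 1 / 2 ^ k" using k(1) False by (simp add: field_simps)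
      moreover have "1 + 1 / norm \<xi> \<le> 2 ^ (k + 2)"
      proof -
        have "(1::real) \<le> 2 ^ Suc k" by (rule one_le_power) simp
        moreover have "(2::real) ^ (k + 2) = 2 * 2 ^ Suc k" by simp
        ultimately show ?thesis using k(2) by linarith
      qed
      ultimately show ?thesis by blast
    qed (auto intro!: exI[of _ 0])
    then obtain k where k: "norm \<xi> \<le> 1 / 2 ^ k" "1 + 1 / norm \<xi> \<le> 2 ^ (k + 2)" by blast
    have "ennreal (?h \<xi>) \<le> g1 k \<xi>"
      unfolding g1_def using k h by (auto intro!: ennreal_leI simp del: power_Suc)
    then show ?thesis unfolding g_def by (intro exI[of _ k] add_increasing2) simp_all
  next
    case False
    then obtain k where k: "2 ^ k \<le> norm \<xi>" "norm \<xi> < 2 ^ Suc k"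
      using dyadic_bracket[of "norm \<xi>"] by auto
    have J: "japanese_bracket \<xi> \<ge> 2 ^ k" using k(1) japanese_bracket_ge_norm[of \<xi>] by linarith
    have pos: "japanese_bracket \<xi> > 0" using japanese_bracket_ge_1[of \<xi>] by linarith
    have "japanese_bracket \<xi> powr (- s) \<le> japanese_bracket \<xi> powr (- real (N + 1))"
      using japanese_bracket_ge_1[of \<xi>] s by (intro powr_mono) (auto simp: N_def)
    also have "\<dots> = (1 / japanese_bracket \<xi>) ^ (N + 1)"
      using pos by (simp only: powr_minus powr_realpow power_one_over inverse_eq_divide)
    also have "\<dots> \<le> (1 / 2 ^ k) ^ (N + 1)"
      using J pos by (intro power_mono divide_left_mono) auto
    finally have "japanese_bracket \<xi> powr (- s) \<le> (1 / 2 ^ k) ^ (N + 1)" .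
    moreover have "1 + 1 / norm \<xi> \<le> 2" using False by (simp add: divide_le_eq_1)
    ultimately have "?h \<xi> \<le> 2 * (1 / 2 ^ k) ^ (N + 1)" by (intro mult_mono) simp_all
    then have "ennreal (?h \<xi>) \<le> g2 k \<xi>"
      unfolding g2_def using k by (auto intro!: ennreal_leI simp del: power_Suc)
    then show ?thesis unfolding g_def by (intro exI[of _ k] add_increasing) simp_all
  qed
  then have "ennreal (?h \<xi>) \<le> (\<Sum>k. g k \<xi>)" for \<xi>
    using sum_le_suminf[of "\<lambda>k. g k \<xi>" "{k}" for k] by (auto intro: order_trans)
  then have "(\<integral>\<^sup>+\<xi>. ennreal (?h \<xi>) \<partial>lborel) \<le> (\<integral>\<^sup>+\<xi>. (\<Sum>k. g k \<xi>) \<partial>lborel)"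
    by (intro nn_integral_mono)
  also have "\<dots> = (\<Sum>k. \<integral>\<^sup>+\<xi>. g k \<xi> \<partial>lborel)"
    by (intro nn_integral_suminf) simp
  also have "\<dots> \<le> (\<Sum>k. ennreal ((4 * V + 2 * 2 ^ N * V) * (1 / 2) ^ k))"
  proof (intro suminf_le)
    fix k
    have "(\<integral>\<^sup>+\<xi>. g1 k \<xi> \<partial>lborel) = ennreal (2 ^ (k + 2)) * ennreal (V * (1 / 2 ^ k) ^ N)"
      unfolding g1_def by (simp add: nn_integral_cmult_indicator emeasure_cball V_def N_def)
    also have "\<dots> = ennreal (4 * V * (2 ^ k * (1 / 2 ^ k) ^ N))"
      using V by (subst ennreal_mult[symmetric]) (auto simp: mult_ac)
    also have "\<dots> \<le> ennreal (4 * V * (1 / 2) ^ k)"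
    proof (intro ennreal_leI mult_left_mono)
      \<comment> \<open>The volume of the small ball contributes at least two powers of its radius,
        because the dimension is at least 2; one of them beats the height
        \<open>2 ^ (k + 2)\<close>, the other makes the series geometric.\<close>
      have "(1 / 2 ^ k :: real) ^ N \<le> (1 / 2 ^ k) ^ 2"
        using n unfolding N_def by (intro power_decreasing) auto
      then have "2 ^ k * (1 / 2 ^ k :: real) ^ N \<le> 2 ^ k * (1 / 2 ^ k) ^ 2"
        by (intro mult_left_mono) auto
      also have "\<dots> = (1 / 2) ^ k" by (simp add: power2_eq_square power_one_over)
      finally show "2 ^ k * (1 / 2 ^ k :: real) ^ N \<le> (1 / 2) ^ k" .
    qed (use V in simp)
    finally have 1: "(\<integral>\<^sup>+\<xi>. g1 k \<xi> \<partial>lborel) \<le> ennreal (4 * V * (1 / 2) ^ k)" .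
    have "(\<integral>\<^sup>+\<xi>. g2 k \<xi> \<partial>lborel) = ennreal (2 * (1 / 2 ^ k) ^ (N + 1)) * ennreal (V * (2 ^ Suc k) ^ N)"
      unfolding g2_def by (simp add: nn_integral_cmult_indicator emeasure_cball V_def N_def)
    also have "\<dots> = ennreal (2 * (1 / 2 ^ k) ^ (N + 1) * (V * (2 ^ Suc k) ^ N))"
      using V by (subst ennreal_mult[symmetric]) auto
    \<comment> \<open>The decay of order \<open>N + 1\<close> exceeds the growth of the volume by
      one power, which again leaves a geometric series.\<close>
    also have "2 * (1 / 2 ^ k) ^ (N + 1) * (V * (2 ^ Suc k) ^ N) = 2 * 2 ^ N * V * (1 / 2) ^ k"
      by (simp add: power_mult_distrib power_one_over)
    finally have 2: "(\<integral>\<^sup>+\<xi>. g2 k \<xi> \<partial>lborel) = ennreal (2 * 2 ^ N * V * (1 / 2) ^ k)" .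
    have "(\<integral>\<^sup>+\<xi>. g k \<xi> \<partial>lborel) = (\<integral>\<^sup>+\<xi>. g1 k \<xi> \<partial>lborel) + (\<integral>\<^sup>+\<xi>. g2 k \<xi> \<partial>lborel)"
      unfolding g_def by (intro nn_integral_add) simp_all
    also have "\<dots> \<le> ennreal (4 * V * (1 / 2) ^ k) + ennreal (2 * 2 ^ N * V * (1 / 2) ^ k)"
      using 1 2 by (intro add_mono) auto
    also have "\<dots> = ennreal ((4 * V + 2 * 2 ^ N * V) * (1 / 2) ^ k)"
      using V by (subst ennreal_plus[symmetric]) (auto simp: algebra_simps)
    finally show "(\<integral>\<^sup>+\<xi>. g k \<xi> \<partial>lborel) \<le> ennreal ((4 * V + 2 * 2 ^ N * V) * (1 / 2) ^ k)" .
  qed simp_all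
  also have "\<dots> < \<infinity>"
  proof -
    have "summable (\<lambda>k. (4 * V + 2 * 2 ^ N * V) * (1 / 2) ^ k)"
      by (intro summable_mult summable_geometric) simp
    then show ?thesis using V by (subst suminf_ennreal2) auto
  qed
  finally have "integrable lborel ?h"
    by (intro integrableI_nonneg) auto
  then show ?thesis by (subst integrable_completion) auto
qed

subsection \<open>Measurability and bounds for the transformed solutions\<close>

text \<open>The solutions are given separately for each parameter, so measurability in the parameter
  at a fixed time has to be derived: \<open>w x t\<close> is the pointwise limit of Taylor sums
  whose coefficients are polynomial in measurable functions.\<close>

lemma linear_ode_measurable:
  fixes w w1 w2 :: "'x \<Rightarrow> real \<Rightarrow> 'a::{banach, second_countable_topology}"
  assumes w: "\<And>x t. t \<ge> 0 \<Longrightarrow> (w x has_vector_derivative w1 x t) (at t within {0..})"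
    and w1: "\<And>x t. t \<ge> 0 \<Longrightarrow> (w1 x has_vector_derivative w2 x t) (at t within {0..})"
    and w2: "\<And>x t. t \<ge> 0 \<Longrightarrow> (w2 x has_vector_derivative
               (p x *\<^sub>R w2 x t + q x *\<^sub>R w1 x t + r x *\<^sub>R w x t)) (at t within {0..})"
    and [measurable]: "p \<in> borel_measurable M" "q \<in> borel_measurable M" "r \<in> borel_measurable M"
      "(\<lambda>x. w x 0) \<in> borel_measurable M" "(\<lambda>x. w1 x 0) \<in> borel_measurable M"
      "(\<lambda>x. w2 x 0) \<in> borel_measurable M"
    and t: "t \<ge> 0"
  shows "(\<lambda>x. w x t) \<in> borel_measurable M"
proof -
  define c where "c = (\<lambda>k. fst (rec_nat (\<lambda>x. w x 0, \<lambda>x. w1 x 0, \<lambda>x. w2 x 0)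
    (\<lambda>_ (f, g, h). (g, h, \<lambda>x. p x *\<^sub>R h x + q x *\<^sub>R g x + r x *\<^sub>R f x)) k))"
  have c: "c 0 = (\<lambda>x. w x 0)" "c 1 = (\<lambda>x. w1 x 0)" "c 2 = (\<lambda>x. w2 x 0)"
    by (simp_all add: c_def numeral_2_eq_2)
  have c_rec: "c (k + 3) = (\<lambda>x. p x *\<^sub>R c (k + 2) x + q x *\<^sub>R c (k + 1) x + r x *\<^sub>R c k x)" for k
    by (simp add: c_def numeral_3_eq_3 numeral_2_eq_2 split: prod.split)
  have "c k \<in> borel_measurable M \<and> c (k + 1) \<in> borel_measurable M \<and> c (k + 2) \<in> borel_measurable M" for k
  proof (induction k)
    case 0 show ?case using c by (simp add: numeral_2_eq_2)
  next
    case (Suc k)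
    then have [measurable]: "c k \<in> borel_measurable M" "c (k + 1) \<in> borel_measurable M"
      "c (k + 2) \<in> borel_measurable M" by auto
    have "c (k + 3) \<in> borel_measurable M" unfolding c_rec by measurable
    then show ?case using Suc by (simp add: numeral_eq_Suc)
  qed
  then have [measurable]: "c k \<in> borel_measurable M" for k by blast
  show ?thesis
  proof (rule borel_measurable_LIMSEQ_metric)
    show "(\<lambda>m. \<Sum>k<m. (t ^ k / fact k) *\<^sub>R c k x) \<longlonglongrightarrow> w x t" for x
      by (rule taylor_series_linear_ode[OF w w1 w2 _ _ _ _ t]) (simp_all only: c c_rec)
  qed measurable
qed

lemma laplace_symbol_measurable:
  "(laplace_symbol :: real^'n::finite \<Rightarrow> real) \<in> borel_measurable lebesgue"
  unfolding laplace_symbol_def by (intro measurable_completion) measurable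

lemma blackstock_ode_measurable:
  fixes w :: "real \<Rightarrow> real^'n::finite \<Rightarrow> complex"
  assumes ode: "\<And>\<xi>. blackstock_ode b \<nu> \<gamma> \<kappa> (laplace_symbol \<xi>) (a0 \<xi>) (a1 \<xi>) (a2 \<xi>) (\<lambda>t. w t \<xi>)"
    and [measurable]: "a0 \<in> borel_measurable lebesgue" "a1 \<in> borel_measurable lebesgue"
      "a2 \<in> borel_measurable lebesgue"
    and t: "t \<ge> 0"
  shows "w t \<in> borel_measurable lebesgue"
proof -
  note [measurable] = laplace_symbol_measurable
  define \<delta> where "\<delta> = b * \<nu> + (\<gamma> - 1) * \<kappa>"
  let ?l = "laplace_symbol :: real^'n \<Rightarrow> real"
  \<comment> \<open>These are the coefficients obtained by solving the Blackstock equation for the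
    third derivative.\<close>
  let ?p = "\<lambda>\<xi>. (\<delta> + \<kappa>) * ?l \<xi>"
  let ?q = "\<lambda>\<xi>. ?l \<xi> - (\<kappa> * \<delta> + \<kappa> * (\<gamma> - 1) * (b * \<nu> - \<kappa>)) * (?l \<xi>)\<^sup>2"
  let ?r = "\<lambda>\<xi>. - \<kappa> * (?l \<xi>)\<^sup>2"
  have "\<exists>w1 w2. (\<forall>t\<ge>0. ((\<lambda>t. w t \<xi>) has_vector_derivative w1 t) (at t within {0..}) \<and>
      (w1 has_vector_derivative w2 t) (at t within {0..}) \<and>
      (w2 has_vector_derivative (?p \<xi> *\<^sub>R w2 t + ?q \<xi> *\<^sub>R w1 t + ?r \<xi> *\<^sub>R w t \<xi>)) (at t within {0..})) \<and>
      w 0 \<xi> = a0 \<xi> \<and> w1 0 = a1 \<xi> \<and> w2 0 = a2 \<xi>" for \<xi>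
  proof -
    obtain w1 w2 w3 where
      d: "\<And>t. t \<ge> 0 \<Longrightarrow> ((\<lambda>t. w t \<xi>) has_vector_derivative w1 t) (at t within {0..})"
        "\<And>t. t \<ge> 0 \<Longrightarrow> (w1 has_vector_derivative w2 t) (at t within {0..})"
        "\<And>t. t \<ge> 0 \<Longrightarrow> (w2 has_vector_derivative w3 t) (at t within {0..})"
      and e: "\<And>t. t \<ge> 0 \<Longrightarrow> (w3 t - of_real (?l \<xi>) * w1 t - of_real (\<delta> * ?l \<xi>) * w2 t)
          - of_real (\<kappa> * ?l \<xi>) * (w2 t - of_real (?l \<xi>) * w t \<xi> - of_real (\<delta> * ?l \<xi>) * w1 t)
          + of_real (\<kappa> * (\<gamma> - 1) * (b * \<nu> - \<kappa>) * (?l \<xi>)\<^sup>2) * w1 t = 0"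
      and i: "w 0 \<xi> = a0 \<xi>" "w1 0 = a1 \<xi>" "w2 0 = a2 \<xi>"
      using ode[of \<xi>] unfolding blackstock_ode_def Let_def \<delta>_def[symmetric] by blast
    have "w3 t = ?p \<xi> *\<^sub>R w2 t + ?q \<xi> *\<^sub>R w1 t + ?r \<xi> *\<^sub>R w t \<xi>" if "t \<ge> 0" for t
      using e[OF that] by (simp add: scaleR_conv_of_real algebra_simps power2_eq_square)
    then show ?thesis using d i by metis
  qed
  then obtain w1 w2 where
    d: "\<And>\<xi> t. t \<ge> 0 \<Longrightarrow> ((\<lambda>t. w t \<xi>) has_vector_derivative w1 \<xi> t) (at t within {0..})"
      "\<And>\<xi> t. t \<ge> 0 \<Longrightarrow> (w1 \<xi> has_vector_derivative w2 \<xi> t) (at t within {0..})"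
      "\<And>\<xi> t. t \<ge> 0 \<Longrightarrow> (w2 \<xi> has_vector_derivative
        (?p \<xi> *\<^sub>R w2 \<xi> t + ?q \<xi> *\<^sub>R w1 \<xi> t + ?r \<xi> *\<^sub>R w t \<xi>)) (at t within {0..})"
    and i: "\<And>\<xi>. w 0 \<xi> = a0 \<xi>" "\<And>\<xi>. w1 \<xi> 0 = a1 \<xi>" "\<And>\<xi>. w2 \<xi> 0 = a2 \<xi>"
    by metis
  show ?thesis
    by (rule linear_ode_measurable[where w = "\<lambda>\<xi> t. w t \<xi>", OF d _ _ _ _ _ _ t])
      (simp_all add: i)
qed

text \<open>Differentiating the equation once brings it into the third-order form.\<close>

lemma viscoelastic_ode_measurable:
  fixes v :: "real \<Rightarrow> real^'n::finite \<Rightarrow> complex"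
  assumes ode: "\<And>\<xi>. viscoelastic_ode b \<nu> (laplace_symbol \<xi>) (a0 \<xi>) (a1 \<xi>) (\<lambda>t. v t \<xi>)"
    and [measurable]: "a0 \<in> borel_measurable lebesgue" "a1 \<in> borel_measurable lebesgue"
    and t: "t \<ge> 0"
  shows "v t \<in> borel_measurable lebesgue"
proof -
  note [measurable] = laplace_symbol_measurable
  let ?l = "laplace_symbol :: real^'n \<Rightarrow> real"
  define a2 where "a2 = (\<lambda>\<xi>. (b * \<nu> * ?l \<xi>) *\<^sub>R a1 \<xi> + ?l \<xi> *\<^sub>R a0 \<xi>)"
  have [measurable]: "a2 \<in> borel_measurable lebesgue" unfolding a2_def by measurable
  have "\<exists>v1 v2. (\<forall>t\<ge>0. ((\<lambda>t. v t \<xi>) has_vector_derivative v1 t) (at t within {0..}) \<and>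
      (v1 has_vector_derivative v2 t) (at t within {0..}) \<and>
      (v2 has_vector_derivative ((b * \<nu> * ?l \<xi>) *\<^sub>R v2 t + ?l \<xi> *\<^sub>R v1 t + 0 *\<^sub>R v t \<xi>)) (at t within {0..})) \<and>
      v 0 \<xi> = a0 \<xi> \<and> v1 0 = a1 \<xi> \<and> v2 0 = a2 \<xi>" for \<xi>
  proof -
    obtain v1 v2 where
      d: "\<And>t. t \<ge> 0 \<Longrightarrow> ((\<lambda>t. v t \<xi>) has_vector_derivative v1 t) (at t within {0..})"
        "\<And>t. t \<ge> 0 \<Longrightarrow> (v1 has_vector_derivative v2 t) (at t within {0..})"
      and e: "\<And>t. t \<ge> 0 \<Longrightarrow>
          v2 t - of_real (?l \<xi>) * v t \<xi> - of_real (b * \<nu> * ?l \<xi>) * v1 t = 0"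
      and i: "v 0 \<xi> = a0 \<xi>" "v1 0 = a1 \<xi>"
      using ode[of \<xi>] unfolding viscoelastic_ode_def by blast
    \<comment> \<open>The function \<open>v2\<close> is not assumed differentiable. The equation
      identifies it on the half-line with this combination of \<open>v\<close> and
      \<open>v1\<close>, whose derivative is known.\<close>
    define V2 where "V2 = (\<lambda>t. (b * \<nu> * ?l \<xi>) *\<^sub>R v1 t + ?l \<xi> *\<^sub>R v t \<xi>)"
    have V2: "v2 t = V2 t" if "t \<ge> 0" for t
      using e[OF that] by (simp add: V2_def scaleR_conv_of_real algebra_simps)
    have "(V2 has_vector_derivative ((b * \<nu> * ?l \<xi>) *\<^sub>R V2 t + ?l \<xi> *\<^sub>R v1 t + 0 *\<^sub>R v t \<xi>))
        (at t within {0..})" if "t \<ge> 0" for t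
      using d[OF that] V2[OF that] unfolding V2_def by (auto intro!: derivative_eq_intros)
    moreover have "V2 0 = a2 \<xi>" by (simp add: V2_def a2_def i)
    ultimately show ?thesis using d V2 i by metis
  qed
  then obtain v1 v2 where
    d: "\<And>\<xi> t. t \<ge> 0 \<Longrightarrow> ((\<lambda>t. v t \<xi>) has_vector_derivative v1 \<xi> t) (at t within {0..})"
      "\<And>\<xi> t. t \<ge> 0 \<Longrightarrow> (v1 \<xi> has_vector_derivative v2 \<xi> t) (at t within {0..})"
      "\<And>\<xi> t. t \<ge> 0 \<Longrightarrow> (v2 \<xi> has_vector_derivative
        ((b * \<nu> * ?l \<xi>) *\<^sub>R v2 \<xi> t + ?l \<xi> *\<^sub>R v1 \<xi> t + 0 *\<^sub>R v t \<xi>)) (at t within {0..})"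
    and i: "\<And>\<xi>. v 0 \<xi> = a0 \<xi>" "\<And>\<xi>. v1 \<xi> 0 = a1 \<xi>" "\<And>\<xi>. v2 \<xi> 0 = a2 \<xi>"
    by metis
  show ?thesis
    by (rule linear_ode_measurable[where w = "\<lambda>\<xi> t. v t \<xi>" and r = "\<lambda>_. 0", OF d _ _ _ _ _ _ t])
      (simp_all add: i)
qed

section \<open>Frequencywise bounds in terms of the data\<close>

text \<open>This bound makes the transform of the viscoelastic solution integrable; together with
  the bound on the difference it gives integrability for the Blackstock solution too.\<close>

lemma viscoelastic_ode_bound:
  assumes pos: "b * \<nu> > 0" "r > 0"
    and ode: "viscoelastic_ode b \<nu> (- r) a0 a1 v" and t: "t \<ge> 0"
  shows "norm (v t) \<le> sqrt (2 * (b * \<nu>)) *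
    (sqrt (1 / (b * \<nu>) + b * \<nu>) * (norm a1 / sqrt r + (1 + sqrt r) * norm a0))"
proof -
  define \<beta> where "\<beta> = b * \<nu>"
  obtain v1 v2 where
    d: "\<And>t. t \<ge> 0 \<Longrightarrow> (v has_vector_derivative v1 t) (at t within {0..})"
      "\<And>t. t \<ge> 0 \<Longrightarrow> (v1 has_vector_derivative v2 t) (at t within {0..})"
    and e: "\<And>t. t \<ge> 0 \<Longrightarrow> v2 t - of_real (- r) * v t - of_real (\<beta> * - r) * v1 t = 0"
    and i: "v 0 = a0" "v1 0 = a1"
    using ode unfolding viscoelastic_ode_def \<beta>_def[symmetric] by blast
  have ode': "v2 t + (\<beta> * r) *\<^sub>R v1 t + r *\<^sub>R v t = 0" if "t \<ge> 0" for t
    using e[OF that] by (simp add: scaleR_conv_of_real algebra_simps)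
  have "(norm (v t))\<^sup>2 \<le> 2 * \<beta> * viscoelastic_energy \<beta> r (v 0) (v1 0)"
    by (rule viscoelastic_bound[OF _ _ d ode' t]) (use pos in \<open>simp_all add: \<beta>_def\<close>)
  also have "\<dots> \<le> 2 * \<beta> * ((1 / \<beta> + \<beta>) * (norm a1 / sqrt r + (1 + sqrt r) * norm a0)\<^sup>2)"
    using pos unfolding i by (intro mult_left_mono viscoelastic_energy_le) (simp_all add: \<beta>_def)
  also have "\<dots> = (sqrt (2 * \<beta>) * (sqrt (1 / \<beta> + \<beta>) * (norm a1 / sqrt r + (1 + sqrt r) * norm a0)))\<^sup>2"
    using pos unfolding \<beta>_def[symmetric] by (simp add: power_mult_distrib)
  finally show ?thesis
    unfolding \<beta>_def[symmetric] by (rule power2_le_imp_le) (use pos in \<open>simp add: \<beta>_def\<close>)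
qed

lemma blackstock_viscoelastic_difference:
  assumes pos: "b * \<nu> > 0" "r > 0" "\<kappa> > 0" and \<gamma>: "1 < \<gamma>" "\<gamma> \<le> 5 / 3"
    and wode: "blackstock_ode b \<nu> \<gamma> \<kappa> (- r) a0 a1 a2 w"
    and a2: "a2 = of_real (b * \<nu>) * (of_real (- r) * a1) + of_real (- r) * a0"
    and vode: "viscoelastic_ode b \<nu> (- r) a0 a1 v" and t: "t \<ge> 0"
  shows "norm (w t - v t) \<le> sqrt \<kappa> *
    (sqrt (1 / (b * \<nu>) + b * \<nu>) * (norm a1 / sqrt r + (1 + sqrt r) * norm a0))"
proof -
  define \<beta> where "\<beta> = b * \<nu>"
  define \<delta> where "\<delta> = \<beta> + (\<gamma> - 1) * \<kappa>"
  have \<beta>: "\<beta> > 0" using pos by (simp add: \<beta>_def)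
  obtain v1 v2 where
    v: "\<And>t. t \<ge> 0 \<Longrightarrow> (v has_vector_derivative v1 t) (at t within {0..})"
      "\<And>t. t \<ge> 0 \<Longrightarrow> (v1 has_vector_derivative v2 t) (at t within {0..})"
    and ve: "\<And>t. t \<ge> 0 \<Longrightarrow> v2 t - of_real (- r) * v t - of_real (\<beta> * - r) * v1 t = 0"
    and vi: "v 0 = a0" "v1 0 = a1"
    using vode unfolding viscoelastic_ode_def \<beta>_def[symmetric] by blast
  obtain w1 w2 w3 where
    w: "\<And>t. t \<ge> 0 \<Longrightarrow> (w has_vector_derivative w1 t) (at t within {0..})"
      "\<And>t. t \<ge> 0 \<Longrightarrow> (w1 has_vector_derivative w2 t) (at t within {0..})"
      "\<And>t. t \<ge> 0 \<Longrightarrow> (w2 has_vector_derivative w3 t) (at t within {0..})"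
    and we: "\<And>t. t \<ge> 0 \<Longrightarrow> (w3 t - of_real (- r) * w1 t - of_real (\<delta> * - r) * w2 t)
        - of_real (\<kappa> * - r) * (w2 t - of_real (- r) * w t - of_real (\<delta> * - r) * w1 t)
        + of_real (\<kappa> * (\<gamma> - 1) * (\<beta> - \<kappa>) * (- r)\<^sup>2) * w1 t = 0"
    and wi: "w 0 = a0" "w1 0 = a1" "w2 0 = a2"
    using wode unfolding blackstock_ode_def Let_def \<beta>_def[symmetric] \<delta>_def[symmetric] by blast
  have v_eq: "v2 t + (\<beta> * r) *\<^sub>R v1 t + r *\<^sub>R v t = 0" if "t \<ge> 0" for t
    using ve[OF that] by (simp add: scaleR_conv_of_real algebra_simps)
  \<comment> \<open>\<open>F\<close> is the viscoelastic operator applied to \<open>w\<close>, and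
    equally to \<open>w - v\<close>, because \<open>v\<close> solves the viscoelastic
    equation.\<close>
  define F where "F = (\<lambda>t. w2 t + (\<beta> * r) *\<^sub>R w1 t + r *\<^sub>R w t)"
  define H where "H = (\<lambda>t. (1 / r) *\<^sub>R F t)"
  have rH: "r *\<^sub>R H t = F t" for t using pos by (simp add: H_def)
  \<comment> \<open>Here the factorisation appears. The value of \<open>\<delta>\<close> turns the
    coefficient of \<open>w2\<close> into \<open>- \<gamma> * \<kappa> * r\<close>, and in that of
    \<open>w1\<close> the contributions quadratic in \<open>\<kappa>\<close> cancel, which leaves a
    multiple of \<open>\<gamma> * \<beta>\<close>.\<close>
  have w3: "w3 t = - ((\<beta> * r) *\<^sub>R w2 t + r *\<^sub>R w1 t)
      + (\<kappa> * r) *\<^sub>R (((\<gamma> - 1) * r) *\<^sub>R w t - \<gamma> *\<^sub>R F t)" if "t \<ge> 0" for t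
    using we[OF that]
    by (simp add: F_def \<delta>_def scaleR_conv_of_real algebra_simps power2_eq_square add_eq_0_iff2)
  have H: "(H has_vector_derivative (\<kappa> * r) *\<^sub>R ((\<gamma> - 1) *\<^sub>R (w t - v t + v t) - \<gamma> *\<^sub>R H t))
      (at t within {0..})" if "t \<ge> 0" for t
  proof -
    have "(H has_vector_derivative (1 / r) *\<^sub>R (w3 t + (\<beta> * r) *\<^sub>R w2 t + r *\<^sub>R w1 t)) (at t within {0..})"
      unfolding H_def F_def using w[OF that] by (auto intro!: derivative_eq_intros)
    also have "w3 t + (\<beta> * r) *\<^sub>R w2 t + r *\<^sub>R w1 t
        = (\<kappa> * r) *\<^sub>R (((\<gamma> - 1) * r) *\<^sub>R w t - \<gamma> *\<^sub>R F t)"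
      using w3[OF that] by simp
    also have "(1 / r) *\<^sub>R \<dots> = (\<kappa> * r) *\<^sub>R ((\<gamma> - 1) *\<^sub>R w t - \<gamma> *\<^sub>R H t)"
      using pos by (simp add: H_def scaleR_diff_right)
    finally show ?thesis by simp
  qed
  have "(norm (w t - v t))\<^sup>2 \<le> \<kappa> * (\<gamma> * (\<gamma> - 1) / 2) * viscoelastic_energy \<beta> r (v 0) (v1 0)"
  proof (rule blackstock_difference_bound[where u = "\<lambda>t. w t - v t" and ?u1.0 = "\<lambda>t. w1 t - v1 t"
        and ?u2.0 = "\<lambda>t. w2 t - v2 t" and H = H, OF \<beta> pos(2) \<gamma>(1) pos(3) v v_eq _ _ _ H])
    fix t :: real assume "t \<ge> 0"
    then show "((\<lambda>t. w t - v t) has_vector_derivative w1 t - v1 t) (at t within {0..})"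
      "((\<lambda>t. w1 t - v1 t) has_vector_derivative w2 t - v2 t) (at t within {0..})"
      using v w by (auto intro!: derivative_intros)
    have "w2 t - v2 t + (\<beta> * r) *\<^sub>R (w1 t - v1 t) + r *\<^sub>R (w t - v t)
        = F t - (v2 t + (\<beta> * r) *\<^sub>R v1 t + r *\<^sub>R v t)"
      by (simp add: F_def scaleR_diff_right)
    then show "w2 t - v2 t + (\<beta> * r) *\<^sub>R (w1 t - v1 t) + r *\<^sub>R (w t - v t) = r *\<^sub>R H t"
      using v_eq[OF \<open>t \<ge> 0\<close>] rH by simp
  next
    show "H 0 = 0"
      by (simp add: H_def F_def wi a2 \<beta>_def scaleR_conv_of_real)
  qed (simp_all add: vi wi t)
  also have "\<dots> \<le> \<kappa> * viscoelastic_energy \<beta> r a0 a1"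
  proof -
    \<comment> \<open>The upper bound on \<open>\<gamma>\<close> gives
      \<open>\<gamma> * (\<gamma> - 1) / 2 \<le> 5 / 9\<close>, so this factor can be replaced by
      1.\<close>
    have "\<gamma> * (\<gamma> - 1) \<le> 5 / 3 * (5 / 3 - 1)" using \<gamma> by (intro mult_mono) auto
    then have "\<kappa> * (\<gamma> * (\<gamma> - 1) / 2) \<le> \<kappa> * 1" using pos by (intro mult_left_mono) auto
    moreover have "0 \<le> viscoelastic_energy \<beta> r a0 a1"
      using viscoelastic_energy_ge[OF \<beta> pos(2), of a0 a1] \<beta>
      by (meson divide_nonneg_pos mult_pos_pos order_trans zero_le_power2 zero_less_numeral)
    ultimately show ?thesis
      unfolding vi by (metis mult.right_neutral mult_right_mono)
  qed
  also have "\<dots> \<le> \<kappa> * ((1 / \<beta> + \<beta>) * (norm a1 / sqrt r + (1 + sqrt r) * norm a0)\<^sup>2)"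
    using pos \<beta> by (intro mult_left_mono viscoelastic_energy_le) simp_all
  also have "\<dots> = (sqrt \<kappa> * (sqrt (1 / \<beta> + \<beta>) * (norm a1 / sqrt r + (1 + sqrt r) * norm a0)))\<^sup>2"
    using pos \<beta> by (simp add: power_mult_distrib)
  finally show ?thesis
    unfolding \<beta>_def[symmetric] by (rule power2_le_imp_le) (use pos \<beta> in simp)
qed

section \<open>From the frequency estimates to the supremum bound in space\<close>

theorem corollary3p2:
  fixes b \<nu> \<gamma> :: real
  assumes "CARD('n::finite) \<ge> 2"
    and "b > 0" and "\<nu> > 0" and "1 < \<gamma>" and "\<gamma> \<le> 5 / 3"
  shows "\<exists>\<kappa>0>0. \<forall>s1>real CARD('n) + 1. \<exists>C>0. \<forall>\<kappa>. 0 < \<kappa> \<and> \<kappa> < \<kappa>0 \<longrightarrow>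
    (\<forall>(\<psi>0 :: real^'n \<Rightarrow> complex) \<psi>1 \<psi>2 D\<psi>0 D\<psi>1 L\<psi>0 L\<psi>1 \<psi> \<psi>v.
       nontrivial \<psi>0 \<and> nontrivial \<psi>1 \<and> nontrivial \<psi>2 \<and>
       japanese_D (s1 + 1) \<psi>0 D\<psi>0 \<and> japanese_D s1 \<psi>1 D\<psi>1 \<and>
       laplacian \<psi>0 L\<psi>0 \<and> laplacian \<psi>1 L\<psi>1 \<and>
       (AE x in lebesgue. \<psi>2 x = of_real (b * \<nu>) * L\<psi>1 x + L\<psi>0 x) \<and>
       blackstock_solution b \<nu> \<gamma> \<kappa> \<psi>0 \<psi>1 \<psi>2 \<psi> \<and>
       viscoelastic_solution b \<nu> \<psi>0 \<psi>1 \<psi>v \<longrightarrow>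
       (let u = (\<lambda>t x. \<psi> t x - \<psi>v t x) in
        (SUP t\<in>{0..}. Linf_norm (u t)) \<le> ereal (sqrt \<kappa> * C * (L1_norm D\<psi>0 + L1_norm D\<psi>1))))"
\<comment> \<open>The frequencywise bounds are uniform over positive \<open>\<kappa>\<close>, so the
  threshold can be the fixed number 1.\<close>
proof (rule exI[of _ 1], intro conjI allI impI)
  fix s1 :: real
  assume s1: "s1 > real CARD('n) + 1"
  define h where "h = (\<lambda>\<xi> :: real^'n. (1 + 1 / norm \<xi>) * japanese_bracket \<xi> powr (- s1))"
  define A where "A = sqrt (1 / (b * \<nu>) + b * \<nu>)"
  \<comment> \<open>The factor 2 comes from the estimate \<open>data\<close>, the power of
    \<open>2 * pi\<close> from Fourier inversion. Adding 1 makes \<open>C\<close> positive once the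
    integral is known to be nonnegative.\<close>
  define C where "C = A * 2 * (LINT \<xi>|lebesgue. h \<xi>) / (2 * pi) ^ CARD('n) + 1"
  have h_int: "integrable lebesgue h"
    unfolding h_def by (rule integrable_singular_weight) (use assms s1 in auto)
  have h_nonneg: "h \<xi> \<ge> 0" for \<xi> by (simp add: h_def)
  have \<beta>: "b * \<nu> > 0" using assms by simp
  then have A: "A > 0" by (simp add: A_def add_pos_pos)
  show "\<exists>C>0. \<forall>\<kappa>. 0 < \<kappa> \<and> \<kappa> < 1 \<longrightarrow>
    (\<forall>(\<psi>0 :: real^'n \<Rightarrow> complex) \<psi>1 \<psi>2 D\<psi>0 D\<psi>1 L\<psi>0 L\<psi>1 \<psi> \<psi>v.
       nontrivial \<psi>0 \<and> nontrivial \<psi>1 \<and> nontrivial \<psi>2 \<and>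
       japanese_D (s1 + 1) \<psi>0 D\<psi>0 \<and> japanese_D s1 \<psi>1 D\<psi>1 \<and>
       laplacian \<psi>0 L\<psi>0 \<and> laplacian \<psi>1 L\<psi>1 \<and>
       (AE x in lebesgue. \<psi>2 x = of_real (b * \<nu>) * L\<psi>1 x + L\<psi>0 x) \<and>
       blackstock_solution b \<nu> \<gamma> \<kappa> \<psi>0 \<psi>1 \<psi>2 \<psi> \<and>
       viscoelastic_solution b \<nu> \<psi>0 \<psi>1 \<psi>v \<longrightarrow>
       (let u = (\<lambda>t x. \<psi> t x - \<psi>v t x) in
        (SUP t\<in>{0..}. Linf_norm (u t)) \<le> ereal (sqrt \<kappa> * C * (L1_norm D\<psi>0 + L1_norm D\<psi>1))))"
  proof (intro exI[of _ C] conjI allI impI)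
    show "C > 0"
      unfolding C_def using A h_nonneg
      by (intro add_nonneg_pos divide_nonneg_pos mult_nonneg_nonneg Bochner_Integration.integral_nonneg) auto
  next
    fix \<kappa> :: real and \<psi>0 \<psi>1 \<psi>2 D\<psi>0 D\<psi>1 L\<psi>0 L\<psi>1 :: "real^'n \<Rightarrow> complex" and \<psi> \<psi>v
    assume \<kappa>: "0 < \<kappa> \<and> \<kappa> < 1"
      and "nontrivial \<psi>0 \<and> nontrivial \<psi>1 \<and> nontrivial \<psi>2 \<and>
       japanese_D (s1 + 1) \<psi>0 D\<psi>0 \<and> japanese_D s1 \<psi>1 D\<psi>1 \<and>
       laplacian \<psi>0 L\<psi>0 \<and> laplacian \<psi>1 L\<psi>1 \<and>
       (AE x in lebesgue. \<psi>2 x = of_real (b * \<nu>) * L\<psi>1 x + L\<psi>0 x) \<and>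
       blackstock_solution b \<nu> \<gamma> \<kappa> \<psi>0 \<psi>1 \<psi>2 \<psi> \<and>
       viscoelastic_solution b \<nu> \<psi>0 \<psi>1 \<psi>v"
    then have D0: "japanese_D (s1 + 1) \<psi>0 D\<psi>0" and D1: "japanese_D s1 \<psi>1 D\<psi>1"
      and L0: "laplacian \<psi>0 L\<psi>0" and L1: "laplacian \<psi>1 L\<psi>1"
      and \<psi>2: "AE x in lebesgue. \<psi>2 x = of_real (b * \<nu>) * L\<psi>1 x + L\<psi>0 x"
      and B: "blackstock_solution b \<nu> \<gamma> \<kappa> \<psi>0 \<psi>1 \<psi>2 \<psi>"
      and VE: "viscoelastic_solution b \<nu> \<psi>0 \<psi>1 \<psi>v"
      by auto
    obtain w where w: "\<And>\<xi>. blackstock_ode b \<nu> \<gamma> \<kappa> (laplace_symbol \<xi>)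
          (fourier \<psi>0 \<xi>) (fourier \<psi>1 \<xi>) (fourier \<psi>2 \<xi>) (\<lambda>t. w t \<xi>)"
      and \<psi>: "\<And>t. t \<ge> 0 \<Longrightarrow> \<psi> t = inverse_fourier (w t)"
      using B unfolding blackstock_solution_def by blast
    obtain v where v: "\<And>\<xi>. viscoelastic_ode b \<nu> (laplace_symbol \<xi>)
          (fourier \<psi>0 \<xi>) (fourier \<psi>1 \<xi>) (\<lambda>t. v t \<xi>)"
      and \<psi>v: "\<And>t. t \<ge> 0 \<Longrightarrow> \<psi>v t = inverse_fourier (v t)"
      using VE unfolding viscoelastic_solution_def by blast
    have int: "integrable lebesgue \<psi>0" "integrable lebesgue \<psi>1"
      "integrable lebesgue L\<psi>0" "integrable lebesgue L\<psi>1"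
      and L: "fourier L\<psi>0 \<xi> = of_real (laplace_symbol \<xi>) * fourier \<psi>0 \<xi>"
      "fourier L\<psi>1 \<xi> = of_real (laplace_symbol \<xi>) * fourier \<psi>1 \<xi>" for \<xi>
      using L0 L1 by (auto simp: laplacian_def L1_symbol_op_def)
    have \<psi>2_int: "integrable lebesgue \<psi>2"
      by (rule fourier_lincomb(1)[OF int(4,3) \<psi>2])
    have a2: "fourier \<psi>2 \<xi> = of_real (b * \<nu>) * (of_real (laplace_symbol \<xi>) * fourier \<psi>1 \<xi>)
        + of_real (laplace_symbol \<xi>) * fourier \<psi>0 \<xi>" for \<xi>
      unfolding fourier_lincomb(2)[OF int(4,3) \<psi>2] L ..
    define N where "N = L1_norm D\<psi>0 + L1_norm D\<psi>1"
    have N: "L1_norm D\<psi>0 \<ge> 0" "L1_norm D\<psi>1 \<ge> 0" "N \<ge> 0" by (auto simp: N_def L1_norm_def)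
    \<comment> \<open>The factor \<open>1 + norm \<xi>\<close> on the transform of
      \<open>\<psi>0\<close> is at most \<open>2 * J\<close> and uses up the additional order of
      regularity of \<open>\<psi>0\<close>. The singular factor falls on \<open>\<psi>1\<close>
      alone.\<close>
    have data: "norm (fourier \<psi>1 \<xi>) / norm \<xi> + (1 + norm \<xi>) * norm (fourier \<psi>0 \<xi>) \<le> 2 * h \<xi> * N" for \<xi>
    proof -
      define J where "J = japanese_bracket \<xi>"
      have J: "J \<ge> 1" "norm \<xi> \<le> J"
        unfolding J_def by (rule japanese_bracket_ge_1 japanese_bracket_ge_norm)+
      have "(1 + norm \<xi>) * norm (fourier \<psi>0 \<xi>) \<le> (2 * J) * (J powr (- (s1 + 1)) * L1_norm D\<psi>0)"
        using J fourier_decay_japanese_D[OF D0, of \<xi>] unfolding J_def by (intro mult_mono) auto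
      also have "\<dots> = 2 * J powr (- s1) * L1_norm D\<psi>0"
        using J powr_mult_base[of J "- (s1 + 1)"] by simp
      also have "norm (fourier \<psi>1 \<xi>) / norm \<xi> \<le> J powr (- s1) * L1_norm D\<psi>1 / norm \<xi>"
        using fourier_decay_japanese_D[OF D1, of \<xi>] unfolding J_def by (intro divide_right_mono) auto
      moreover have "J powr (- s1) * L1_norm D\<psi>1 / norm \<xi> \<le> 2 * h \<xi> * L1_norm D\<psi>1"
      proof -
        have "2 * h \<xi> * L1_norm D\<psi>1 = J powr (- s1) * L1_norm D\<psi>1 / norm \<xi> +
            (2 * J powr (- s1) * L1_norm D\<psi>1 + J powr (- s1) * L1_norm D\<psi>1 / norm \<xi>)"
          unfolding h_def J_def[symmetric] by (simp add: algebra_simps)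
        moreover have "0 \<le> 2 * J powr (- s1) * L1_norm D\<psi>1 + J powr (- s1) * L1_norm D\<psi>1 / norm \<xi>"
          using N(2) by simp
        ultimately show ?thesis by linarith
      qed
      moreover have "2 * J powr (- s1) * L1_norm D\<psi>0 \<le> 2 * h \<xi> * L1_norm D\<psi>0"
        using N(1) unfolding h_def J_def[symmetric]
        by (intro mult_right_mono) (simp_all add: mult_le_cancel_right1)
      ultimately show ?thesis unfolding N_def by (simp add: distrib_left)
    qed
    have Linf: "Linf_norm (\<lambda>x. \<psi> t x - \<psi>v t x) \<le> ereal (sqrt \<kappa> * C * N)" if t: "t \<ge> 0" for t
    proof -
      have wm: "w t \<in> borel_measurable lebesgue"
        by (rule blackstock_ode_measurable[OF w _ _ _ t]) (intro fourier_measurable int \<psi>2_int)+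
      have vm: "v t \<in> borel_measurable lebesgue"
        by (rule viscoelastic_ode_measurable[OF v _ _ t]) (intro fourier_measurable int)+
      have diff: "norm (w t \<xi> - v t \<xi>) \<le> sqrt \<kappa> * (A * (2 * N * h \<xi>))"
        and vb: "norm (v t \<xi>) \<le> sqrt (2 * (b * \<nu>)) * (A * (2 * N * h \<xi>))" if "\<xi> \<noteq> 0" for \<xi>
      proof -
        have r: "(norm \<xi>)\<^sup>2 > 0" using that by simp
        have l: "laplace_symbol \<xi> = - (norm \<xi>)\<^sup>2" by (simp add: laplace_symbol_def)
        have "norm (w t \<xi> - v t \<xi>) \<le> sqrt \<kappa> *
            (A * (norm (fourier \<psi>1 \<xi>) / sqrt ((norm \<xi>)\<^sup>2) + (1 + sqrt ((norm \<xi>)\<^sup>2)) * norm (fourier \<psi>0 \<xi>)))"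
          unfolding A_def
          by (rule blackstock_viscoelastic_difference[OF \<beta> r _ _ _ w[of \<xi>, unfolded l] _ v[of \<xi>, unfolded l] t])
            (use \<kappa> assms a2[of \<xi>, unfolded l] in auto)
        also have "\<dots> \<le> sqrt \<kappa> * (A * (2 * N * h \<xi>))"
          using A \<kappa> data[of \<xi>] by (intro mult_left_mono) (auto simp: mult_ac)
        finally show "norm (w t \<xi> - v t \<xi>) \<le> sqrt \<kappa> * (A * (2 * N * h \<xi>))" .
        have "norm (v t \<xi>) \<le> sqrt (2 * (b * \<nu>)) *
            (A * (norm (fourier \<psi>1 \<xi>) / sqrt ((norm \<xi>)\<^sup>2) + (1 + sqrt ((norm \<xi>)\<^sup>2)) * norm (fourier \<psi>0 \<xi>)))"
          unfolding A_def by (rule viscoelastic_ode_bound[OF \<beta> r v[of \<xi>, unfolded l] t])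
        also have "\<dots> \<le> sqrt (2 * (b * \<nu>)) * (A * (2 * N * h \<xi>))"
          using A \<beta> data[of \<xi>] by (intro mult_left_mono) (auto simp: mult_ac)
        finally show "norm (v t \<xi>) \<le> sqrt (2 * (b * \<nu>)) * (A * (2 * N * h \<xi>))" .
      qed
      \<comment> \<open>The energy estimates divide by the squared frequency, so frequency zero is
        discarded as a null set.\<close>
      have AE0: "AE \<xi> in lebesgue. (\<xi> :: real^'n) \<noteq> 0"
        by (rule AE_completion) (rule AE_lborel_singleton)
      have vint: "integrable lebesgue (v t)"
        by (rule Bochner_Integration.integrable_bound
              [where f = "\<lambda>\<xi>. sqrt (2 * (b * \<nu>)) * (A * (2 * N * h \<xi>))"])
          (use AE0 vb h_int vm A N h_nonneg \<beta> in \<open>auto elim!: eventually_mono\<close>)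
      have dint: "integrable lebesgue (\<lambda>\<xi>. w t \<xi> - v t \<xi>)"
        by (rule Bochner_Integration.integrable_bound[where f = "\<lambda>\<xi>. sqrt \<kappa> * (A * (2 * N * h \<xi>))"])
          (use AE0 diff h_int vm wm A N h_nonneg \<kappa> in \<open>auto elim!: eventually_mono\<close>)
      have wint: "integrable lebesgue (w t)"
        using Bochner_Integration.integrable_add[OF dint vint] by simp
      \<comment> \<open>Splitting the inverse transform requires both transforms to be integrable,
        since the integral of a non-integrable function is 0 by convention.\<close>
      have u: "\<psi> t x - \<psi>v t x = inverse_fourier (\<lambda>\<xi>. w t \<xi> - v t \<xi>) x" for x
        by (simp add: \<psi>[OF t] \<psi>v[OF t] inverse_fourier_eq_fourier fourier_diff[OF wint vint] diff_divide_distrib)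
      have "continuous_on UNIV (\<lambda>x. inverse_fourier (\<lambda>\<xi>. w t \<xi> - v t \<xi>) x)"
        unfolding inverse_fourier_eq_fourier
        by (intro continuous_intros continuous_on_compose2[OF continuous_on_fourier[OF dint]]) auto
      then have "(\<lambda>x. inverse_fourier (\<lambda>\<xi>. w t \<xi> - v t \<xi>) x) \<in> borel_measurable lebesgue"
        by (intro measurable_completion) (simp add: borel_measurable_continuous_onI)
      \<comment> \<open>The essential supremum of a non-measurable function is the top element by
        definition, so a pointwise bound alone would not suffice.\<close>
      then have meas: "(\<lambda>x. ereal (norm (\<psi> t x - \<psi>v t x))) \<in> borel_measurable lebesgue"
        unfolding u by measurable
      have "L1_norm (\<lambda>\<xi>. w t \<xi> - v t \<xi>) \<le> (LINT \<xi>|lebesgue. sqrt \<kappa> * (A * (2 * N * h \<xi>)))"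
        unfolding L1_norm_def using dint h_int AE0 diff
        by (intro integral_mono_AE) (auto elim!: eventually_mono)
      also have "\<dots> = sqrt \<kappa> * N * (A * 2 * (LINT \<xi>|lebesgue. h \<xi>))" by simp
      finally have L1: "L1_norm (\<lambda>\<xi>. w t \<xi> - v t \<xi>) \<le> sqrt \<kappa> * N * (A * 2 * (LINT \<xi>|lebesgue. h \<xi>))" .
      have "norm (\<psi> t x - \<psi>v t x) \<le> sqrt \<kappa> * C * N" for x
      proof -
        have "norm (\<psi> t x - \<psi>v t x)
            = norm (fourier (\<lambda>\<xi>. w t \<xi> - v t \<xi>) (- x)) / (2 * pi) ^ CARD('n)"
          unfolding u inverse_fourier_eq_fourier by (simp add: norm_divide norm_power norm_mult)
        also have "\<dots> \<le> sqrt \<kappa> * N * (A * 2 * (LINT \<xi>|lebesgue. h \<xi>)) / (2 * pi) ^ CARD('n)"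
          by (intro divide_right_mono order_trans[OF norm_fourier_le L1]) simp
        also have "\<dots> = sqrt \<kappa> * N * (C - 1)" by (simp add: C_def)
        also have "\<dots> \<le> sqrt \<kappa> * N * C" using \<kappa> N by (intro mult_left_mono) auto
        finally show ?thesis by (simp add: mult_ac)
      qed
      then show ?thesis
        unfolding Linf_norm_def by (intro esssup_I meas AE_I2) simp
    qed
    show "let u = (\<lambda>t x. \<psi> t x - \<psi>v t x) in
        (SUP t\<in>{0..}. Linf_norm (u t)) \<le> ereal (sqrt \<kappa> * C * (L1_norm D\<psi>0 + L1_norm D\<psi>1))"
      unfolding Let_def N_def[symmetric] by (intro SUP_least Linf) simp
  qed
qed simp

end
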